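(* Let $R$ be an aperiodic two-step rule, $\theta$ a step direction and $x,y\in(0,\infty)$. Write $\rho=\rho(x,y)$. If $B_\theta^{(0,1,0)}(\rho;x,y)\neq0$ then $$\mathbb E_m(\mathbf x;x,y)\sim x\,\delta_{\mathbf x}\cdot m\qquad\text{as }m\to\infty,$$ where $$\delta_{\mathbf x}\equiv\delta_{\mathbf x}(x,y)=\frac{B_\theta^{(0,1,0)}(\rho;x,y)}{\rho\,B_\theta^{(1,0,0)}(\rho;x,y)}.$$ If instead $B_\theta^{(0,1,0)}(\rho;x,y)=0$ then, as $m\to\infty$, $$\mathbb E_m(\mathbf x;x,y)\sim x\left(-\frac{B_\theta^{(1,1,0)}(\rho;x,y)}{B_\theta^{(1,0,0)}(\rho;x,y)}+\frac{A_\theta^{(0,1,0)}(\rho;x,y)}{A_\theta(\rho;x,y)}\right).$$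
   Context: Steps on $\mathbb Z^2$: east $(1,0)$, north $(0,1)$, west $(-1,0)$, south $(0,-1)$, abbreviated $e,n,w,s$. A two-step rule is a map $R:\{e,n,w,s\}^2\to\{0,1\}$; $R(i,j)=1$ means a step of type $i$ may be immediately followed by one of type $j$. Its transfer matrix is $T=(R(i,j))_{i,j}$. The rule is aperiodic if there is $k\ge1$ with $(T^k)_{ij}>0$ for all $i,j$. A walk obeying $R$ is a nonempty finite sequence of steps, starting at the origin, with arbitrary first step and with $R(i,j)=1$ for each consecutive pair $(i,j)$. The generating function of a class of walks is $\sum t^m x^a y^b$ over walks in the class, where $m$ is the length and $(a,b)$ the endpoint. $A_\theta(t;x,y)$: walks obeying $R$, with any first step, containing exactly one $\theta$ step, which is their last step. $B_\theta(t;x,y)$: walks obeying $R$ whose first step $j$ satisfies $R(\theta,j)=1$, containing exactly one $\theta$ step, which is their last step. These are rational functions. Superscripts $(i,j,k)$ denote the partial derivative taken $i$ times in $t$, $j$ times in $x$ and $k$ times in $y$. $\rho(x,y)$ is the smallest positive $t$ with $B_\theta(t;x,y)=1$; it exists and does not depend on $\theta$. $\Theta_m(x,y)=\sum_{a,b}\theta_{m,a,b}x^ay^b$, where $\theta_{m,a,b}$ is the number of walks of length $m$ obeying $R$ (in the full plane), ending with a $\theta$ step at $(a,b)$. Each walk $\gamma$ of length $m$ ending with a $\theta$ step, at $(a,b)$, is given probability $x^ay^b/\Theta_m(x,y)$, and $\mathbb E_m(\mathbf x;x,y)$ is the expected $\mathbf x$-coordinate of the endpoint under this distribution: $$\mathbb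 E_m(\mathbf x;x,y)=\frac{\sum_{a,b}a\,\theta_{m,a,b}x^ay^b}{\Theta_m(x,y)}.$$ In the second case the right-hand side is constant in $m$, and $\sim$ is read as convergence to that constant (in particular when the constant is $0$). *)

theory Defs
  imports "HOL-Analysis.Analysis" "HOL-Library.Landau_Symbols"
begin

datatype step = East | North | West | South

instance step :: finite
proof
  have "(UNIV :: step set) \<subseteq> {East, North, West, South}"
    using step.exhaust by auto
  then show "finite (UNIV :: step set)"
    by (rule finite_subset) simp
qed

fun dx :: "step \<Rightarrow> int" where
  "dx East = 1" | "dx West = -1" | "dx North = 0" | "dx South = 0"

fun dy :: "step \<Rightarrow> int" where
  "dy North = 1" | "dy South = -1" | "dy East = 0" | "dy West = 0"

type_synonym rule = "step \<Rightarrow> step \<Rightarrow> bool"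

definition transfer_matrix :: "rule \<Rightarrow> real ^ step ^ step" where
  "transfer_matrix R = (\<chi> i j. of_bool (R i j))"

(* Multiplication of the vector type is componentwise, so the matrix power
   is written as an iterated matrix product. *)
definition aperiodic :: "rule \<Rightarrow> bool" where
  "aperiodic R \<longleftrightarrow>
     (\<exists>k\<ge>1. \<forall>i j. (((**) (transfer_matrix R)) ^^ k) (mat 1) $ i $ j > 0)"

definition walk :: "rule \<Rightarrow> step list \<Rightarrow> bool" where
  "walk R w \<longleftrightarrow> w \<noteq> [] \<and> successively R w"

definition end_x :: "step list \<Rightarrow> int" where
  "end_x w = (\<Sum>s\<leftarrow>w. dx s)"

definition end_y :: "step list \<Rightarrow> int" where
  "end_y w = (\<Sum>s\<leftarrow>w. dy s)"

(* The sum of the series at real arguments, i.e. the value of the rational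
   function wherever the series converges, and 0 where it does not. For the
   classes below, the series converges on a neighbourhood of (rho, x, y). *)
definition gen_fun :: "step list set \<Rightarrow> real \<Rightarrow> real \<Rightarrow> real \<Rightarrow> real" where
  "gen_fun C t x y = (\<Sum>\<^sub>\<infinity>w\<in>C. t ^ length w * x powi end_x w * y powi end_y w)"

definition A_walks :: "rule \<Rightarrow> step \<Rightarrow> step list set" where
  "A_walks R \<theta> = {w. walk R w \<and> count_list w \<theta> = 1 \<and> last w = \<theta>}"

definition B_walks :: "rule \<Rightarrow> step \<Rightarrow> step list set" where
  "B_walks R \<theta> = {w. walk R w \<and> R \<theta> (hd w) \<and> count_list w \<theta> = 1 \<and> last w = \<theta>}"

definition A_gf :: "rule \<Rightarrow> step \<Rightarrow> real \<Rightarrow> real \<Rightarrow> real \<Rightarrow> real" where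
  "A_gf R \<theta> = gen_fun (A_walks R \<theta>)"

definition B_gf :: "rule \<Rightarrow> step \<Rightarrow> real \<Rightarrow> real \<Rightarrow> real \<Rightarrow> real" where
  "B_gf R \<theta> = gen_fun (B_walks R \<theta>)"

definition partial_deriv ::
    "nat \<Rightarrow> nat \<Rightarrow> nat \<Rightarrow> (real \<Rightarrow> real \<Rightarrow> real \<Rightarrow> real) \<Rightarrow> real \<Rightarrow> real \<Rightarrow> real \<Rightarrow> real" where
  "partial_deriv i j k F t x y =
     (deriv ^^ i) (\<lambda>t'. (deriv ^^ j) (\<lambda>x'. (deriv ^^ k) (\<lambda>y'. F t' x' y') y) x) t"

definition rho :: "rule \<Rightarrow> step \<Rightarrow> real \<Rightarrow> real \<Rightarrow> real" where
  "rho R \<theta> x y = (LEAST t. t > 0 \<and> B_gf R \<theta> t x y = 1)"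

definition theta_count :: "rule \<Rightarrow> step \<Rightarrow> nat \<Rightarrow> int \<Rightarrow> int \<Rightarrow> nat" where
  "theta_count R \<theta> m a b =
     card {w. walk R w \<and> length w = m \<and> last w = \<theta> \<and> end_x w = a \<and> end_y w = b}"

(* The sums over all integer pairs below have finite support. *)
definition Theta :: "rule \<Rightarrow> step \<Rightarrow> nat \<Rightarrow> real \<Rightarrow> real \<Rightarrow> real" where
  "Theta R \<theta> m x y =
     (\<Sum>\<^sub>\<infinity>(a, b)\<in>UNIV. real (theta_count R \<theta> m a b) * x powi a * y powi b)"

definition expected_x :: "rule \<Rightarrow> step \<Rightarrow> nat \<Rightarrow> real \<Rightarrow> real \<Rightarrow> real" where
  "expected_x R \<theta> m x y =
     (\<Sum>\<^sub>\<infinity>(a, b)\<in>UNIV. of_int a * real (theta_count R \<theta> m a b) * x powi a * y powi b)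
       / Theta R \<theta> m x y"

definition delta_x :: "rule \<Rightarrow> step \<Rightarrow> real \<Rightarrow> real \<Rightarrow> real" where
  "delta_x R \<theta> x y =
     partial_deriv 0 1 0 (B_gf R \<theta>) (rho R \<theta> x y) x y /
       (rho R \<theta> x y * partial_deriv 1 0 0 (B_gf R \<theta>) (rho R \<theta> x y) x y)"

end

theory Submission
  imports Defs "HOL-Complex_Analysis.Cauchy_Integral_Formula"
begin

text \<open>
  Fix \<open>x, y > 0\<close> and give a walk ending at \<open>(a, b)\<close> the weight \<open>x^a y^b\<close>, which is multiplicative
  under concatenation. A walk ending with a \<open>\<theta>\<close> step is cut behind its \<open>\<theta>\<close> steps into one walk
  counted by \<open>A\<close> and then any number of walks counted by \<open>B\<close>. So the series
  \<open>T = \<Sum> \<Theta>\<^sub>m t^m\<close> is \<open>A / (1 - B)\<close>. The numerators of the expected values have the series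
  \<open>D = x \<partial>T/\<partial>x\<close>, and with \<open>A' = x \<partial>A/\<partial>x\<close> and \<open>B' = x \<partial>B/\<partial>x\<close> this is
  \<open>D = A' / (1 - B) + A B' / (1 - B)^2\<close>. Only the dominant singularity \<open>\<rho>\<close> of \<open>1 / (1 - B)\<close> matters.

  Everything rests on three facts about \<open>\<rho>\<close>. First, the series \<open>A\<close> and \<open>B\<close> converge beyond \<open>\<rho>\<close>
  (lemmas \<open>B_series_eq_1_exists\<close> and \<open>fps_conv_radius_A_walks\<close>). In matrix terms, deleting a
  state from a primitive matrix lowers its spectral radius; the proof here avoids
  Perron--Frobenius theory by using that the weights of
  \<open>\<theta>\<close>-avoiding walks are submultiplicative in the length. Secondly, \<open>\<rho>\<close> is the only
  zero of \<open>1 - B\<close> in the closed disc of radius \<open>\<rho>\<close>, because \<open>B\<close> has nonnegative coefficients and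
  aperiodicity forbids a common period of the lengths of the walks it counts. Thirdly, this zero is
  simple, because the derivative of \<open>B\<close> is positive there.

  Hence \<open>1 / (1 - B) = C / (1 - t/\<rho>)\<close> with a series \<open>C\<close> that converges beyond \<open>\<rho>\<close> and with
  \<open>C(\<rho>) = 1/\<mu>\<close>, where \<open>\<mu> = \<rho> \<partial>B/\<partial>t (\<rho>)\<close> (lemma \<open>aperiodic_renewal_factorization\<close>). Dividing by \<open>1 - t/\<rho>\<close> turns
  coefficients, scaled by \<open>\<rho>^m\<close>, into partial sums. Therefore \<open>\<Theta>\<^sub>m \<rho>^m\<close> tends to \<open>A(\<rho>)/\<mu>\<close>, and the scaled
  coefficients of \<open>D\<close> are \<open>(m + 1) A(\<rho>) B'(\<rho>) / \<mu>^2\<close> plus a convergent sequence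
  (lemma \<open>renewal_asymptotics\<close>). If \<open>B'(\<rho>)\<close> is not zero, the linear term gives the drift.
  If it is zero, \<open>A B' C^2\<close> has a zero at \<open>\<rho>\<close> that cancels one pole, and the limit of the convergent
  sequence is the constant claimed. Term-by-term differentiation (lemma \<open>partial_derivs_gen_fun\<close>)
  identifies these values with the partial derivatives in the statement.
\<close>

section \<open>Aperiodicity in terms of walks\<close>

text \<open>
  The walk excludes the starting direction \<open>i\<close>, so that its length is the exponent.
\<close>
lemma transfer_matrix_power_pos_imp_walk:
  assumes "(((**) (transfer_matrix R)) ^^ k) (mat 1) $ i $ j > 0"
  shows "\<exists>w. length w = k \<and> successively R (i # w) \<and> last (i # w) = j"
  using assms
proof (induction k arbitrary: i)
  case 0
  thus ?case by (simp add: mat_def split: if_splits)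
next
  case (Suc k)
  let ?M = "(((**) (transfer_matrix R)) ^^ k) (mat 1)"
  have "(\<Sum>l\<in>UNIV. transfer_matrix R $ i $ l * ?M $ l $ j) > 0"
  proof -
    have "(transfer_matrix R ** ?M) $ i $ j > 0" using Suc.prems by simp
    thus ?thesis unfolding matrix_matrix_mult_def by simp
  qed
  then obtain l where "transfer_matrix R $ i $ l * ?M $ l $ j > 0"
    by (metis (no_types, lifting) not_less sum_nonpos)
  hence "R i l" "?M $ l $ j > 0" 
    by (cases "R i l"; simp add: transfer_matrix_def)+
  with Suc.IH obtain w where "length w = k" "successively R (l # w)" "last (l # w) = j" by blast
  thus ?case using \<open>R i l\<close> by (intro exI[of _ "l # w"]) simp
qed

text \<open>
  Every direction has a successor, so connections of length \<open>k\<close> between all pairs prolong to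
  connections of length \<open>k + 1\<close>. Two consecutive lengths have no common divisor, which is how
  aperiodicity excludes further poles.
\<close>
lemma aperiodic_imp_walks_of_consecutive_lengths:
  assumes "aperiodic R"
  obtains k where "k \<ge> 1"
    "\<And>i j. \<exists>w. length w = k \<and> successively R (i # w) \<and> last (i # w) = j"
    "\<And>i j. \<exists>w. length w = Suc k \<and> successively R (i # w) \<and> last (i # w) = j"
proof -
  obtain k where k: "k \<ge> 1" "\<And>i j. (((**) (transfer_matrix R)) ^^ k) (mat 1) $ i $ j > 0"
    using assms by (auto simp: aperiodic_def)
  have P: "\<exists>w. length w = k \<and> successively R (i # w) \<and> last (i # w) = j" for i j
    by (rule transfer_matrix_power_pos_imp_walk[OF k(2)])
  have "\<exists>w. length w = Suc k \<and> successively R (i # w) \<and> last (i # w) = j" for i j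
  proof -
    obtain v where v: "length v = k" "successively R (i # v)" using P by blast
    then obtain l where l: "R i l" using k(1) by (cases v) auto
    obtain w where "length w = k" "successively R (l # w)" "last (l # w) = j" using P by blast
    thus ?thesis using l by (intro exI[of _ "l # w"]) simp
  qed
  thus ?thesis using that k(1) P by blast
qed

unbundle no vec_syntax
unbundle fps_syntax

section \<open>Power series with a single simple pole\<close>

lemma fps_conv_radius_mono:
  fixes F G :: "real fps"
  assumes "\<And>n. \<bar>G $ n\<bar> \<le> \<bar>F $ n\<bar>"
  shows "fps_conv_radius F \<le> fps_conv_radius G"
  unfolding fps_conv_radius_def
proof (rule conv_radius_geI_ex')
  fix r :: real assume r: "0 < r" "ereal r < conv_radius (fps_nth F)"
  have "summable (\<lambda>n. norm (F $ n * r ^ n))"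
    using r by (intro abs_summable_in_conv_radius) auto
  thus "summable (\<lambda>n. G $ n * of_real r ^ n)"
    by (rule summable_comparison_test[rotated])
       (use assms r in \<open>auto simp: abs_mult intro!: exI[of _ 0] mult_right_mono\<close>)
qed

lemma fps_mult_one_minus_cX_nth_Suc:
  fixes F :: "'a::comm_ring_1 fps"
  shows "((1 - fps_const c * fps_X) * F) $ Suc n = F $ Suc n - c * F $ n"
  by (simp add: ring_distribs mult.assoc)

text \<open>
  The series \<open>1 / (1 - t/\<rho>)\<close> is geometric, so multiplying by it sums up the terms at \<open>\<rho>\<close>.
\<close>
lemma fps_nth_quotient_one_minus_cX:
  fixes F G :: "real fps"
  assumes "\<rho> \<noteq> 0" and eq: "(1 - fps_const (1 / \<rho>) * fps_X) * G = F"
  shows "G $ n * \<rho> ^ n = (\<Sum>k\<le>n. F $ k * \<rho> ^ k)"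
proof (induction n)
  case 0
  have "F $ 0 = G $ 0" unfolding eq[symmetric] by (simp add: algebra_simps)
  thus ?case by simp
next
  case (Suc n)
  have "F $ Suc n = G $ Suc n - 1 / \<rho> * G $ n"
    unfolding eq[symmetric] by (rule fps_mult_one_minus_cX_nth_Suc)
  hence "F $ Suc n * \<rho> ^ Suc n = G $ Suc n * \<rho> ^ Suc n - G $ n * \<rho> ^ n"
    using assms(1) by (simp add: left_diff_distrib)
  thus ?case using Suc.IH by simp
qed

lemma fps_quotient_one_minus_cX_limit:
  fixes F G :: "real fps"
  assumes \<rho>: "0 < \<rho>" "ereal \<rho> < fps_conv_radius F"
    and eq: "(1 - fps_const (1 / \<rho>) * fps_X) * G = F"
  shows "(\<lambda>n. G $ n * \<rho> ^ n) \<longlonglongrightarrow> eval_fps F \<rho>"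
proof -
  have "(\<lambda>n. F $ n * \<rho> ^ n) sums eval_fps F \<rho>"
    using \<rho> by (intro sums_eval_fps) auto
  hence "(\<lambda>n. \<Sum>k\<le>n. F $ k * \<rho> ^ k) \<longlonglongrightarrow> eval_fps F \<rho>"
    by (simp add: sums_def_le)
  thus ?thesis using fps_nth_quotient_one_minus_cX[OF _ eq] \<rho>(1) by simp
qed

lemma eval_fps_one_minus_cX [simp]:
  fixes c z :: "'a::{banach,real_normed_field}"
  shows "eval_fps (1 - fps_const c * fps_X) z = 1 - c * z"
proof -
  have "fps_conv_radius (fps_const c * fps_X :: 'a fps) = \<infinity>"
    using fps_conv_radius_mult[of "fps_const c" "fps_X :: 'a fps"] by simp
  thus ?thesis by (simp add: eval_fps_diff eval_fps_mult)
qed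

lemma fps_conv_radius_one_minus_cX [simp]:
  fixes c :: "'a::{banach,real_normed_field}"
  shows "fps_conv_radius (1 - fps_const c * fps_X :: 'a fps) = \<infinity>"
proof -
  have "fps_conv_radius (fps_const c * fps_X :: 'a fps) = \<infinity>"
    using fps_conv_radius_mult[of "fps_const c" "fps_X :: 'a fps"] by simp
  thus ?thesis using fps_conv_radius_diff[of 1 "fps_const c * fps_X :: 'a fps"] by simp
qed

text \<open>
  A zero can be divided out without loss of convergence: the scaled coefficients of the quotient are
  partial sums of a series with sum zero, hence minus its tails, and the tails of a series that
  converges beyond \<open>\<rho>\<close> decay exponentially.
\<close>
lemma fps_divide_by_zero_factor:
  fixes F :: "real fps"
  assumes \<rho>: "0 < \<rho>" "ereal \<rho> < fps_conv_radius F" and zero: "eval_fps F \<rho> = 0"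
  obtains G where "F = (1 - fps_const (1 / \<rho>) * fps_X) * G" "ereal \<rho> < fps_conv_radius G"
    "eval_fps G \<rho> = - \<rho> * eval_fps (fps_deriv F) \<rho>"
proof -
  define L :: "real fps" where "L = 1 - fps_const (1 / \<rho>) * fps_X"
  have L0: "L $ 0 \<noteq> 0" by (simp add: L_def)
  define G where "G = inverse L * F"
  have eq: "L * G = F" using inverse_mult_eq_1[OF L0] by (simp add: G_def mult.assoc[symmetric] mult.commute[of L])
  have G_nth: "G $ n * \<rho> ^ n = (\<Sum>k\<le>n. F $ k * \<rho> ^ k)" for n
    using fps_nth_quotient_one_minus_cX[of \<rho> G F] eq \<rho> by (simp add: L_def)
  obtain s where s: "\<rho> < s" "ereal s < fps_conv_radius F"
    using ereal_dense2[OF \<rho>(2)] by auto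
  have "summable (\<lambda>n. norm (F $ n * s ^ n))"
    using s \<rho> by (intro norm_summable_fps) auto
  hence sum_s: "summable (\<lambda>n. \<bar>F $ n\<bar> * s ^ n)" using s \<rho> by (simp add: abs_mult)
  define K where "K = (\<Sum>n. \<bar>F $ n\<bar> * s ^ n)"
  have sum_\<rho>: "summable (\<lambda>n. F $ n * \<rho> ^ n)" "(\<Sum>n. F $ n * \<rho> ^ n) = 0"
    using sums_eval_fps[of \<rho> F] \<rho> zero by (auto simp: sums_iff)
  \<comment> \<open>the partial sums of a convergent series with sum zero are minus its tails\<close>
  have bound: "\<bar>G $ n\<bar> * s ^ n \<le> K" for n
  proof -
    have "summable (\<lambda>i. F $ (i + Suc n) * \<rho> ^ (i + Suc n))"
      using summable_iff_shift[of "\<lambda>n. F $ n * \<rho> ^ n" "Suc n"] sum_\<rho> by simp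
    have eq0: "0 = (\<Sum>i. F $ (i + Suc n) * \<rho> ^ (i + Suc n)) + G $ n * \<rho> ^ n"
      using suminf_split_initial_segment[OF sum_\<rho>(1), of "Suc n"] sum_\<rho>(2)
      by (simp add: G_nth lessThan_Suc_atMost)
    have sum_tail: "summable (\<lambda>i. \<bar>F $ (i + Suc n)\<bar> * s ^ (i + Suc n))"
      using summable_iff_shift[of "\<lambda>n. \<bar>F $ n\<bar> * s ^ n" "Suc n"] sum_s by simp
    have le: "norm (F $ (i + Suc n) * \<rho> ^ (i + Suc n)) \<le> (\<rho> / s) ^ n * (\<bar>F $ (i + Suc n)\<bar> * s ^ (i + Suc n))" for i
    proof -
      have "\<rho> ^ (i + Suc n) = (\<rho> / s) ^ (i + Suc n) * s ^ (i + Suc n)"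
        using s \<rho> by (simp add: power_divide)
      also have "\<dots> \<le> (\<rho> / s) ^ n * s ^ (i + Suc n)"
        using s \<rho> by (intro mult_right_mono power_decreasing) auto
      finally have "\<bar>F $ (i + Suc n)\<bar> * \<rho> ^ (i + Suc n) \<le> \<bar>F $ (i + Suc n)\<bar> * ((\<rho> / s) ^ n * s ^ (i + Suc n))"
        by (intro mult_left_mono) auto
      thus ?thesis using \<rho>
        by (simp only: abs_mult real_norm_def power_abs abs_of_pos mult.left_commute)
    qed
    have "(\<Sum>i. F $ (i + Suc n) * \<rho> ^ (i + Suc n)) = - (G $ n * \<rho> ^ n)"
      using eq0 by linarith
    hence "\<bar>G $ n\<bar> * \<rho> ^ n = norm (\<Sum>i. F $ (i + Suc n) * \<rho> ^ (i + Suc n))"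
      using \<rho> by (simp only: real_norm_def abs_minus_cancel abs_mult power_abs abs_of_pos)
    also have "\<dots> \<le> (\<Sum>i. (\<rho> / s) ^ n * (\<bar>F $ (i + Suc n)\<bar> * s ^ (i + Suc n)))"
      by (intro norm_suminf_le le summable_mult sum_tail)
    also have "\<dots> = (\<rho> / s) ^ n * (\<Sum>i. \<bar>F $ (i + Suc n)\<bar> * s ^ (i + Suc n))"
      by (intro suminf_mult sum_tail)
    also have "(\<Sum>i. \<bar>F $ (i + Suc n)\<bar> * s ^ (i + Suc n)) \<le> K"
      using suminf_split_initial_segment[OF sum_s, of "Suc n"] s \<rho>
        sum_nonneg[of "{..<Suc n}" "\<lambda>n. \<bar>F $ n\<bar> * s ^ n"] by (simp add: K_def)
    hence "(\<rho> / s) ^ n * (\<Sum>i. \<bar>F $ (i + Suc n)\<bar> * s ^ (i + Suc n)) \<le> (\<rho> / s) ^ n * K"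
      using \<rho> s by (intro mult_left_mono) auto
    finally have "\<bar>G $ n\<bar> * \<rho> ^ n \<le> (\<rho> / s) ^ n * K" .
    thus ?thesis using \<rho> s by (simp add: power_divide field_simps)
  qed
  have "ereal s \<le> fps_conv_radius G"
    unfolding fps_conv_radius_def
  proof (rule conv_radius_geI_ex')
    fix r :: real assume r: "0 < r" "ereal r < ereal s"
    have "summable (\<lambda>n. K * (r / s) ^ n)"
      using r by (intro summable_mult summable_geometric) auto
    moreover have "norm (G $ n * r ^ n) \<le> K * (r / s) ^ n" for n
    proof -
      have "norm (G $ n * r ^ n) = (\<bar>G $ n\<bar> * s ^ n) * (r / s) ^ n"
        using r by (simp add: abs_mult power_divide)
      also have "\<dots> \<le> K * (r / s) ^ n" using r bound by (intro mult_right_mono) auto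
      finally show ?thesis .
    qed
    ultimately have "summable (\<lambda>n. G $ n * r ^ n)"
      by (rule summable_comparison_test')
    thus "summable (\<lambda>n. G $ n * of_real r ^ n)" by simp
  qed
  hence rad: "ereal \<rho> < fps_conv_radius G" using s(1)
    by (metis ereal_less_eq(3) less_ereal.simps(1) order_less_le_trans)
  have "fps_deriv F = fps_deriv L * G + L * fps_deriv G"
    unfolding eq[symmetric] by simp
  also have "fps_deriv L = - fps_const (1 / \<rho>)" by (simp add: L_def)
  finally have dF: "fps_deriv F = L * fps_deriv G - fps_const (1 / \<rho>) * G"
    by (simp only: mult_minus_left) simp
  have rad': "ereal \<rho> < fps_conv_radius (fps_deriv G)"
    using rad fps_conv_radius_deriv[of G] by order
  have "eval_fps (fps_deriv F) \<rho> = eval_fps (L * fps_deriv G) \<rho> - eval_fps (fps_const (1 / \<rho>) * G) \<rho>"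
    unfolding dF using rad rad' \<rho> fps_conv_radius_mult[of L "fps_deriv G"] 
      fps_conv_radius_mult[of "fps_const (1/\<rho>)" G]
    by (intro eval_fps_diff) (auto simp: L_def min_def split: if_splits)
  also have "\<dots> = - (1 / \<rho>) * eval_fps G \<rho>"
    using rad rad' \<rho> by (simp add: eval_fps_mult L_def)
  finally have "eval_fps G \<rho> = - \<rho> * eval_fps (fps_deriv F) \<rho>" using \<rho> by simp
  thus ?thesis using that[of G] eq rad by (simp add: L_def)
qed

text \<open>
  The walk series are real, but their zeros have to be excluded on a complex disc.
\<close>
definition complex_fps :: "real fps \<Rightarrow> complex fps" where
  "complex_fps F = Abs_fps (\<lambda>n. complex_of_real (F $ n))"

lemma complex_fps_nth [simp]: "complex_fps F $ n = complex_of_real (F $ n)"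
  by (simp add: complex_fps_def)

lemma complex_fps_mult: "complex_fps (F * G) = complex_fps F * complex_fps G"
  by (simp add: fps_eq_iff fps_mult_nth)

lemma complex_fps_conv_radius [simp]: "fps_conv_radius (complex_fps F) = fps_conv_radius F"
  by (simp add: fps_conv_radius_def conv_radius_def)

lemma complex_fps_eval_of_real:
  assumes "ereal \<bar>t\<bar> < fps_conv_radius F"
  shows "eval_fps (complex_fps F) (of_real t) = of_real (eval_fps F t)"
proof -
  have "(\<lambda>n. F $ n * t ^ n) sums eval_fps F t" using assms by (intro sums_eval_fps) auto
  hence "(\<lambda>n. complex_of_real (F $ n * t ^ n)) sums of_real (eval_fps F t)" by (rule sums_of_real)
  thus ?thesis by (simp add: eval_fps_def sums_iff)
qed

text \<open>
  By compactness, a function without zeros on the closed disc has none on a slightly larger disc,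
  and the reciprocal of a zero-free holomorphic function is holomorphic.
\<close>
lemma fps_inverse_exists_beyond_zero_free_disc:
  fixes Q :: "real fps"
  assumes \<rho>: "0 < \<rho>" "ereal \<rho> < fps_conv_radius Q"
    and nz: "\<And>z. norm z \<le> \<rho> \<Longrightarrow> eval_fps (complex_fps Q) z \<noteq> 0"
  obtains C where "Q * C = 1" "ereal \<rho> < fps_conv_radius C"
proof -
  define U where "U = {z \<in> eball 0 (fps_conv_radius Q). eval_fps (complex_fps Q) z \<noteq> 0}"
  have "open U"
  proof -
    have "open (eball 0 (fps_conv_radius Q) \<inter> eval_fps (complex_fps Q) -` (- {0}))"
      using continuous_on_eval_fps[of "complex_fps Q"]
      by (intro continuous_open_preimage) auto
    also have "\<dots> = U" by (auto simp: U_def)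
    finally show ?thesis .
  qed
  moreover have "cball 0 \<rho> \<subseteq> U"
    using nz \<rho> by (auto simp: U_def intro: le_less_trans[of _ "ereal \<rho>"])
  ultimately obtain \<epsilon> where \<epsilon>: "\<epsilon> > 0" "(\<Union>x\<in>cball 0 \<rho>. ball x \<epsilon>) \<subseteq> U"
    using compact_subset_open_imp_ball_epsilon_subset[of "cball (0::complex) \<rho>" U] by auto
  have nz': "eval_fps (complex_fps Q) z \<noteq> 0" if "norm z < \<rho> + \<epsilon>" for z
  proof (cases "norm z \<le> \<rho>")
    case False
    \<comment> \<open>radial projection to the closed disc\<close>
    define w where "w = (\<rho> / norm z) *\<^sub>R z"
    have "z - w = ((norm z - \<rho>) / norm z) *\<^sub>R z" using False \<rho>
      by (simp add: w_def algebra_simps diff_divide_distrib)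
    moreover have z0: "z \<noteq> 0" using False \<rho> by auto
    ultimately have "dist w z = norm z - \<rho>" using False \<rho> by (simp add: dist_norm norm_minus_commute[of w])
    moreover have "norm w = \<rho>" using z0 \<rho> by (simp add: w_def)
    ultimately have "z \<in> U" using \<epsilon>(2) that by (force simp: subset_iff)
    thus ?thesis by (simp add: U_def)
  qed (use nz in auto)
  define C where "C = inverse Q"
  have "eval_fps (complex_fps Q) 0 \<noteq> 0" using nz \<rho> by simp
  hence Q0: "Q $ 0 \<noteq> 0" by (simp add: eval_fps_at_0)
  hence QC: "Q * C = 1" unfolding C_def by (simp add: inverse_mult_eq_1')
  have "complex_fps Q * complex_fps C = 1"
    using QC by (simp flip: complex_fps_mult) (simp add: fps_eq_iff)
  hence inv: "complex_fps C = inverse (complex_fps Q)"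
    using Q0 by (metis complex_fps_nth fps_inverse_unique of_real_eq_0_iff)
  have "ereal \<rho> < min (ereal (\<rho> + \<epsilon>)) (fps_conv_radius (complex_fps Q))"
    using \<rho> \<epsilon> by simp
  also have "\<dots> \<le> fps_conv_radius (inverse (complex_fps Q))"
    using \<rho> \<epsilon> by (intro fps_conv_radius_inverse nz') auto
  finally have "ereal \<rho> < fps_conv_radius C" unfolding inv[symmetric] by simp
  thus ?thesis using QC that by blast
qed

text \<open>
  The case of equality in the triangle inequality: an average of points of the closed unit disc
  equals \<open>1\<close> only if every point with positive weight is \<open>1\<close>.
\<close>
lemma power_series_eq_total_mass_imp_unit_powers:
  fixes b :: "nat \<Rightarrow> real" and w :: complex
  assumes nonneg: "\<And>k. b k \<ge> 0" and sums: "b sums 1" and w: "norm w \<le> 1"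
    and eq: "(\<lambda>k. of_real (b k) * w ^ k) sums 1" and k: "b k \<noteq> 0"
  shows "w ^ k = 1"
proof -
  have Re_le: "Re (w ^ k) \<le> 1" for k
    using complex_Re_le_cmod[of "w ^ k"] power_le_one[OF _ w, of k] by (simp add: norm_power)
  have "(\<lambda>k. Re (of_real (b k) * w ^ k)) sums Re 1" using eq by (rule sums_Re)
  hence "(\<lambda>k. b k - b k * Re (w ^ k)) sums (1 - 1)"
    using sums_diff[OF sums] by fastforce
  hence s: "(\<lambda>k. b k * (1 - Re (w ^ k))) sums 0" by (simp add: algebra_simps)
  have "\<forall>k. b k * (1 - Re (w ^ k)) = 0"
    using s suminf_eq_zero_iff[of "\<lambda>k. b k * (1 - Re (w ^ k))"] nonneg Re_le
    by (auto simp: sums_iff)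
  hence Re1: "Re (w ^ k) = 1" using k by auto
  have "norm (w ^ k) \<le> 1" using power_le_one[OF _ w, of k] by (simp add: norm_power)
  hence "(Re (w^k))\<^sup>2 + (Im (w^k))\<^sup>2 \<le> 1"
    by (simp add: cmod_def real_sqrt_le_1_iff)
  hence "Im (w ^ k) = 0" using Re1 by simp
  thus ?thesis using Re1 by (simp add: complex_eq_iff)
qed

text \<open>
  This is where aperiodicity acts. After the zero \<open>\<rho>\<close> is divided out of \<open>1 - B\<close>, the remaining factor
  \<open>Q\<close> has no zero in the closed disc: a zero \<open>z\<close> would satisfy \<open>B(z) = 1 = B(\<rho>)\<close>, which forces
  \<open>z = \<rho>\<close>, and \<open>Q(\<rho>)\<close> is \<open>\<rho>\<close> times the derivative of \<open>B\<close> at \<open>\<rho>\<close>. Its inverse is \<open>C\<close>.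
\<close>
lemma aperiodic_renewal_factorization:
  fixes B :: "real fps"
  assumes nonneg: "\<And>k. B $ k \<ge> 0"
    and \<rho>: "0 < \<rho>" "ereal \<rho> < fps_conv_radius B" and one: "eval_fps B \<rho> = 1"
    and aper: "\<forall>z::complex. (\<forall>k. B $ k \<noteq> 0 \<longrightarrow> z ^ k = 1) \<longrightarrow> z = 1"
    and deriv: "eval_fps (fps_deriv B) \<rho> \<noteq> 0"
  obtains C where "(1 - B) * C = 1 - fps_const (1 / \<rho>) * fps_X" "ereal \<rho> < fps_conv_radius C"
    "eval_fps C \<rho> = 1 / (\<rho> * eval_fps (fps_deriv B) \<rho>)"
proof -
  define L :: "real fps" where "L = 1 - fps_const (1 / \<rho>) * fps_X"
  have rad1B: "ereal \<rho> < fps_conv_radius (1 - B)"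
    using fps_conv_radius_diff[of 1 B] \<rho> by (simp add: min_def split: if_splits)
  have "eval_fps (1 - B) \<rho> = 0" using one \<rho> by (simp add: eval_fps_diff)
  then obtain Q where Q: "1 - B = L * Q" "ereal \<rho> < fps_conv_radius Q"
      "eval_fps Q \<rho> = - \<rho> * eval_fps (fps_deriv (1 - B)) \<rho>"
    using fps_divide_by_zero_factor[OF \<rho>(1) rad1B] by (auto simp: L_def)
  have radB': "ereal \<rho> < fps_conv_radius (fps_deriv B)"
    using fps_conv_radius_deriv[of B] \<rho> by order
  have Q\<rho>: "eval_fps Q \<rho> = \<rho> * eval_fps (fps_deriv B) \<rho>"
    using Q(3) radB' \<rho> by (simp add: eval_fps_minus)
  have "eval_fps (complex_fps Q) z \<noteq> 0" if z: "norm z \<le> \<rho>" for z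
  proof
    assume Qz: "eval_fps (complex_fps Q) z = 0"
    have zrad: "ereal (norm z) < fps_conv_radius B" "ereal (norm z) < fps_conv_radius Q"
      using z \<rho> Q(2) by (auto intro: le_less_trans[of _ "ereal \<rho>"])
    have "1 - complex_fps B = complex_fps (1 - B)" by (simp add: fps_eq_iff)
    also have "\<dots> = complex_fps L * complex_fps Q" by (simp add: Q(1) complex_fps_mult)
    also have "complex_fps L = 1 - fps_const (1 / of_real \<rho>) * fps_X"
      by (simp add: L_def fps_eq_iff)
    finally have "eval_fps (1 - complex_fps B) z
        = eval_fps ((1 - fps_const (1 / of_real \<rho>) * fps_X) * complex_fps Q) z" by simp
    also have "\<dots> = 0" using zrad Qz by (simp add: eval_fps_mult)
    finally have "eval_fps (complex_fps B) z = 1" using zrad by (simp add: eval_fps_diff)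
    hence s1: "(\<lambda>k. of_real (B $ k) * z ^ k) sums 1"
      using sums_eval_fps[of z "complex_fps B"] zrad by simp
    define w where "w = z / of_real \<rho>"
    have zw: "z = of_real \<rho> * w" using \<rho> by (simp add: w_def)
    have "w = 1"
    proof (rule aper[rule_format])
      fix k assume "B $ k \<noteq> 0"
      show "w ^ k = 1"
      proof (rule power_series_eq_total_mass_imp_unit_powers[where b = "\<lambda>k. B $ k * \<rho> ^ k"])
        show "(\<lambda>k. B $ k * \<rho> ^ k) sums 1" using sums_eval_fps[of \<rho> B] \<rho> one by simp
        show "(\<lambda>k. of_real (B $ k * \<rho> ^ k) * w ^ k) sums 1"
          using s1 by (simp add: zw power_mult_distrib mult.assoc)
        show "norm w \<le> 1" using z \<rho> by (simp add: w_def norm_divide)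
      qed (use nonneg \<rho> \<open>B $ k \<noteq> 0\<close> in auto)
    qed
    hence "eval_fps (complex_fps Q) (of_real \<rho>) = 0" using Qz zw by simp
    hence "eval_fps Q \<rho> = 0" using complex_fps_eval_of_real[of \<rho> Q] Q(2) \<rho> by simp
    thus False using Q\<rho> \<rho> deriv by simp
  qed
  then obtain C where C: "Q * C = 1" "ereal \<rho> < fps_conv_radius C"
    using fps_inverse_exists_beyond_zero_free_disc[OF \<rho>(1) Q(2)] by blast
  have "(1 - B) * C = L" using C(1) by (simp add: Q(1) mult.assoc)
  moreover have "eval_fps Q \<rho> * eval_fps C \<rho> = 1"
    using C Q(2) \<rho> by (subst eval_fps_mult[symmetric]) auto
  hence "eval_fps C \<rho> = 1 / (\<rho> * eval_fps (fps_deriv B) \<rho>)"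
    unfolding Q\<rho>[symmetric] by (metis mult.commute mult_zero_left nonzero_eq_divide_eq zero_neq_one)
  ultimately show ?thesis using C(2) that by (simp add: L_def)
qed

text \<open>
  With \<open>L = 1 - t/\<rho>\<close> the equations become \<open>L T = A C\<close> and
  \<open>L\<^sup>2 D = L A' C + F\<close>, where \<open>F = A B' C\<^sup>2\<close>. Subtracting the constant \<open>\<phi> = F(\<rho>)\<close> makes the second
  numerator vanish at \<open>\<rho>\<close>, so it cancels one factor \<open>L\<close> and contributes a convergent sequence; the
  constant itself contributes \<open>\<phi> / L\<^sup>2\<close>, that is \<open>(m + 1) \<phi>\<close> after scaling. If \<open>B'(\<rho>) = 0\<close>, the limit
  is read off from the derivative of \<open>F\<close>, in which only the term with the derivative of \<open>B'\<close> survives.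
\<close>
lemma renewal_asymptotics:
  fixes A A' B B' T D :: "real fps"
  assumes nonneg: "\<And>k. B $ k \<ge> 0"
    and \<rho>: "0 < \<rho>"
    and rad: "ereal \<rho> < fps_conv_radius A" "ereal \<rho> < fps_conv_radius A'"
      "ereal \<rho> < fps_conv_radius B" "ereal \<rho> < fps_conv_radius B'"
    and one: "eval_fps B \<rho> = 1"
    and aper: "\<forall>z::complex. (\<forall>k. B $ k \<noteq> 0 \<longrightarrow> z ^ k = 1) \<longrightarrow> z = 1"
    and deriv: "eval_fps (fps_deriv B) \<rho> \<noteq> 0"
    and T: "T = A + T * B" and D: "D = A' + D * B + T * B'"
  defines "\<mu> \<equiv> \<rho> * eval_fps (fps_deriv B) \<rho>"
    and "\<phi> \<equiv> eval_fps A \<rho> * eval_fps B' \<rho> / (\<rho> * eval_fps (fps_deriv B) \<rho>)\<^sup>2"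
  shows "(\<lambda>m. T $ m * \<rho> ^ m) \<longlonglongrightarrow> eval_fps A \<rho> / \<mu>"
    and "\<exists>c. (\<lambda>m. D $ m * \<rho> ^ m - real (Suc m) * \<phi>) \<longlonglongrightarrow> c"
    and "eval_fps B' \<rho> = 0 \<Longrightarrow> (\<lambda>m. D $ m * \<rho> ^ m) \<longlonglongrightarrow>
           eval_fps A' \<rho> / \<mu> - eval_fps A \<rho> * (\<rho> * eval_fps (fps_deriv B') \<rho>) / \<mu>\<^sup>2"
proof -
  define L :: "real fps" where "L = 1 - fps_const (1 / \<rho>) * fps_X"
  obtain C where C: "(1 - B) * C = L" "ereal \<rho> < fps_conv_radius C" "eval_fps C \<rho> = 1 / \<mu>"
    using aperiodic_renewal_factorization[OF nonneg \<rho> rad(3) one aper deriv]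
    unfolding L_def \<mu>_def by blast
  have radM: "ereal \<rho> < fps_conv_radius (F * G)"
    if "ereal \<rho> < fps_conv_radius F" "ereal \<rho> < fps_conv_radius G" for F G :: "real fps"
    using that fps_conv_radius_mult[of F G] by (simp add: min_def split: if_splits)
  have radP: "ereal \<rho> < fps_conv_radius (F + G)"
    if "ereal \<rho> < fps_conv_radius F" "ereal \<rho> < fps_conv_radius G" for F G :: "real fps"
    using that fps_conv_radius_add[of F G] by (simp add: min_def split: if_splits)
  have radD: "ereal \<rho> < fps_conv_radius (fps_deriv F)"
    if "ereal \<rho> < fps_conv_radius F" for F :: "real fps"
    using that fps_conv_radius_deriv[of F] by order
  have "T * (1 - B) = A" using T by (simp add: right_diff_distrib) (metis add_diff_cancel_right')
  moreover have "L * T = T * (1 - B) * C" unfolding C(1)[symmetric] by (simp only: ac_simps)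
  ultimately have LT: "L * T = A * C" by simp
  have "(\<lambda>m. T $ m * \<rho> ^ m) \<longlonglongrightarrow> eval_fps (A * C) \<rho>"
    using LT \<rho> radM[OF rad(1) C(2)] unfolding L_def
    by (intro fps_quotient_one_minus_cX_limit) auto
  also have "eval_fps (A * C) \<rho> = eval_fps A \<rho> / \<mu>" using rad(1) C \<rho> by (simp add: eval_fps_mult)
  finally show "(\<lambda>m. T $ m * \<rho> ^ m) \<longlonglongrightarrow> eval_fps A \<rho> / \<mu>" .

  define F where "F = A * B' * (C * C)"
  have radF: "ereal \<rho> < fps_conv_radius F" unfolding F_def by (intro radM rad C)
  have F\<rho>: "eval_fps F \<rho> = \<phi>"
    using radM rad C \<rho> by (simp add: F_def eval_fps_mult \<phi>_def \<mu>_def power2_eq_square)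
  have "ereal \<rho> < fps_conv_radius (F - fps_const \<phi>)"
    using fps_conv_radius_diff[of F "fps_const \<phi>"] radF by (simp add: min_def split: if_splits)
  moreover have "eval_fps (F - fps_const \<phi>) \<rho> = 0"
    using radF F\<rho> \<rho> by (simp add: eval_fps_diff)
  ultimately obtain G where G: "F - fps_const \<phi> = L * G" "ereal \<rho> < fps_conv_radius G"
      "eval_fps G \<rho> = - \<rho> * eval_fps (fps_deriv (F - fps_const \<phi>)) \<rho>"
    using fps_divide_by_zero_factor[OF \<rho>] unfolding L_def by blast
  define S where "S = fps_const \<phi> * inverse L"
  have "L $ 0 \<noteq> 0" by (simp add: L_def)
  hence LS: "L * S = fps_const \<phi>" unfolding S_def
    by (simp add: mult.left_commute inverse_mult_eq_1')
  have S_nth: "S $ m * \<rho> ^ m = \<phi>" for m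
  proof -
    have "S $ m * \<rho> ^ m = (\<Sum>k\<le>m. fps_const \<phi> $ k * \<rho> ^ k)"
      using fps_nth_quotient_one_minus_cX[OF _ LS[unfolded L_def]] \<rho> by simp
    also have "\<dots> = \<phi>"
      by (subst sum.remove[of _ 0]) (auto intro!: sum.neutral)
    finally show ?thesis .
  qed
  have "D * (1 - B) = A' + T * B'" using D by (simp add: right_diff_distrib) (metis add.commute add.left_commute add_diff_cancel_left')
  moreover have "L * D = D * (1 - B) * C" unfolding C(1)[symmetric] by (simp only: ac_simps)
  ultimately have "L * D = A' * C + T * B' * C" by (simp add: distrib_right)
  hence "L * (L * D) = L * (A' * C) + (L * T) * B' * C" by (simp add: algebra_simps)
  also have "\<dots> = L * (A' * C) + F" unfolding LT F_def by (simp add: algebra_simps)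
  also have "F = L * G + L * S" using G(1) LS by (simp add: algebra_simps)
  finally have "L * (L * D) = L * (A' * C + G + S)" by (simp add: algebra_simps)
  hence LD: "L * D = A' * C + G + S" using \<open>L $ 0 \<noteq> 0\<close> by (metis fps_nonzero_nth mult_left_cancel)
  have D_nth: "D $ m * \<rho> ^ m - real (Suc m) * \<phi> = (\<Sum>k\<le>m. (A' * C + G) $ k * \<rho> ^ k)" for m
  proof -
    have "D $ m * \<rho> ^ m = (\<Sum>k\<le>m. (A' * C + G + S) $ k * \<rho> ^ k)"
      using fps_nth_quotient_one_minus_cX[OF _ LD[unfolded L_def]] \<rho> by simp
    also have "\<dots> = (\<Sum>k\<le>m. (A' * C + G) $ k * \<rho> ^ k) + real (Suc m) * \<phi>"
      by (simp only: fps_add_nth[of _ S] distrib_right sum.distrib S_nth) simp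
    finally show ?thesis by simp
  qed
  have radE: "ereal \<rho> < fps_conv_radius (A' * C + G)" by (intro radP radM rad C G)
  have lim: "(\<lambda>m. D $ m * \<rho> ^ m - real (Suc m) * \<phi>) \<longlonglongrightarrow> eval_fps (A' * C + G) \<rho>"
    unfolding D_nth using sums_eval_fps[of \<rho> "A' * C + G"] radE \<rho> by (simp add: sums_def_le)
  thus "\<exists>c. (\<lambda>m. D $ m * \<rho> ^ m - real (Suc m) * \<phi>) \<longlonglongrightarrow> c" by blast
  assume B'0: "eval_fps B' \<rho> = 0"
  hence "\<phi> = 0" by (simp add: \<phi>_def)
  have "eval_fps (fps_deriv F) \<rho>
      = eval_fps (A * B' * fps_deriv (C * C) + (A * fps_deriv B' + fps_deriv A * B') * (C * C)) \<rho>"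
    by (simp add: F_def)
  also have "\<dots> = eval_fps A \<rho> * eval_fps (fps_deriv B') \<rho> * (1 / \<mu> * (1 / \<mu>))"
    using B'0 \<rho> by (simp add: eval_fps_add eval_fps_mult radM radD radP rad C del: fps_deriv_mult)
  finally have "eval_fps G \<rho> = - \<rho> * (eval_fps A \<rho> * eval_fps (fps_deriv B') \<rho> * (1 / \<mu> * (1 / \<mu>)))"
    using G(3) \<open>\<phi> = 0\<close> by simp
  hence "eval_fps (A' * C + G) \<rho>
      = eval_fps A' \<rho> / \<mu> - eval_fps A \<rho> * (\<rho> * eval_fps (fps_deriv B') \<rho>) / \<mu>\<^sup>2"
    using \<rho> by (simp add: eval_fps_add eval_fps_mult radM rad C G(2) power2_eq_square)
  thus "(\<lambda>m. D $ m * \<rho> ^ m) \<longlonglongrightarrow>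
           eval_fps A' \<rho> / \<mu> - eval_fps A \<rho> * (\<rho> * eval_fps (fps_deriv B') \<rho>) / \<mu>\<^sup>2"
    using lim \<open>\<phi> = 0\<close> by simp
qed

section \<open>Cutting walks at the direction \<theta>\<close>

definition theta_walks :: "rule \<Rightarrow> step \<Rightarrow> step list set" where
  "theta_walks R \<theta> = {w. walk R w \<and> last w = \<theta>}"

text \<open>
  The empty sequence is included, so that deleting the final \<open>\<theta>\<close> of a walk counted by \<open>A\<close> always
  leaves an avoiding walk.
\<close>
definition avoiding_walks :: "rule \<Rightarrow> step \<Rightarrow> step list set" where
  "avoiding_walks R \<theta> = {w. successively R w \<and> \<theta> \<notin> set w}"

text \<open>
  The power series in the length variable alone, with the dependence on \<open>x\<close> and \<open>y\<close> kept in the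
  weight \<open>f\<close>. The weight \<open>end_x w * weight x y w\<close> gives \<open>x\<close> times the partial derivative in \<open>x\<close>.
\<close>
definition gfps :: "step list set \<Rightarrow> (step list \<Rightarrow> real) \<Rightarrow> real fps" where
  "gfps C f = Abs_fps (\<lambda>m. \<Sum>w | w \<in> C \<and> length w = m. f w)"

lemma gfps_nth [simp]: "fps_nth (gfps C f) m = (\<Sum>w | w \<in> C \<and> length w = m. f w)"
  by (simp add: gfps_def)

definition weight :: "real \<Rightarrow> real \<Rightarrow> step list \<Rightarrow> real" where
  "weight x y w = x powi end_x w * y powi end_y w"

lemma finite_words_of_length [simp, intro]: "finite {w \<in> C. length w = m}" for C :: "step list set"
  by (rule finite_subset[OF _ finite_lists_length_eq[of "UNIV :: step set" m]]) auto

lemma end_x_append [simp]: "end_x (v @ w) = end_x v + end_x w"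
  by (simp add: end_x_def)

lemma end_y_append [simp]: "end_y (v @ w) = end_y v + end_y w"
  by (simp add: end_y_def)

lemma abs_end_x_le: "\<bar>end_x w\<bar> \<le> int (length w)"
proof (induction w)
  case (Cons a w)
  have "\<bar>dx a\<bar> \<le> 1" by (cases a) auto
  moreover have "end_x (a # w) = dx a + end_x w" by (simp add: end_x_def)
  ultimately show ?case using Cons.IH by simp
qed (simp add: end_x_def)

lemma weight_append:
  "x > 0 \<Longrightarrow> y > 0 \<Longrightarrow> weight x y (v @ w) = weight x y v * weight x y w"
  by (simp add: weight_def power_int_add)

lemma weight_pos [simp, intro]: "x > 0 \<Longrightarrow> y > 0 \<Longrightarrow> weight x y w > 0"
  by (simp add: weight_def)

lemma weight_nonneg [simp, intro]: "x > 0 \<Longrightarrow> y > 0 \<Longrightarrow> weight x y w \<ge> 0"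
  by (intro less_imp_le weight_pos)

lemma walk_append:
  "v \<noteq> [] \<Longrightarrow> u \<noteq> [] \<Longrightarrow> walk R (v @ u) \<longleftrightarrow> walk R v \<and> walk R u \<and> R (last v) (hd u)"
  by (auto simp: walk_def successively_append_iff)

lemma B_walks_subset_A_walks: "B_walks R \<theta> \<subseteq> A_walks R \<theta>"
  by (auto simp: A_walks_def B_walks_def)

lemma A_walks_subset_theta_walks: "A_walks R \<theta> \<subseteq> theta_walks R \<theta>"
  by (auto simp: A_walks_def theta_walks_def)

lemma theta_walk_append_B_walk:
  assumes "v \<in> theta_walks R \<theta>" "u \<in> B_walks R \<theta>"
  shows "v @ u \<in> theta_walks R \<theta> - A_walks R \<theta>"
proof -
  have "\<theta> \<in> set v" using assms(1) last_in_set[of v] by (auto simp: theta_walks_def walk_def)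
  hence "count_list v \<theta> \<noteq> 0" by (simp add: count_list_0_iff)
  thus ?thesis using assms
    by (auto simp: theta_walks_def B_walks_def A_walks_def walk_append)
       (auto simp: walk_def successively_append_iff)
qed

text \<open>
  The cut is behind the last but one \<open>\<theta>\<close>.
\<close>
lemma theta_walk_split:
  assumes "w \<in> theta_walks R \<theta> - A_walks R \<theta>"
  obtains v u where "w = v @ u" "v \<in> theta_walks R \<theta>" "u \<in> B_walks R \<theta>"
proof -
  have w: "walk R w" "last w = \<theta>" "w \<noteq> []" "count_list w \<theta> \<noteq> 1"
    using assms by (auto simp: theta_walks_def A_walks_def walk_def)
  have ww: "w = butlast w @ [\<theta>]" using w by (metis append_butlast_last_id)
  hence "count_list (butlast w) \<theta> \<noteq> 0" using w(4)
    by (metis add_cancel_right_left count_list.simps count_list_append One_nat_def add.commute)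
  hence "\<theta> \<in> set (butlast w)" by (simp add: count_list_0_iff)
  then obtain ys zs where ys: "butlast w = ys @ \<theta> # zs" "\<theta> \<notin> set zs"
    using split_list_last[of \<theta> "butlast w"] by blast
  have eq: "w = (ys @ [\<theta>]) @ (zs @ [\<theta>])" using ww ys by simp
  have "walk R (ys @ [\<theta>])" "walk R (zs @ [\<theta>])" "R \<theta> (hd (zs @ [\<theta>]))"
    using w(1) unfolding eq by (subst (asm) walk_append; simp)+
  thus ?thesis using that[OF eq] ys(2)
    by (simp add: theta_walks_def B_walks_def count_list_0_iff)
qed

text \<open>
  If two cuts differed, the longer suffix would contain the \<open>\<theta>\<close> that ends the longer prefix in
  addition to its own final \<open>\<theta>\<close>.
\<close>
lemma B_walk_suffix_unique:
  assumes "v @ u = v' @ u'" "v \<in> theta_walks R \<theta>" "v' \<in> theta_walks R \<theta>"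
    "u \<in> B_walks R \<theta>" "u' \<in> B_walks R \<theta>"
  shows "v = v' \<and> u = u'"
proof -
  have *: "us = []" if "last (p @ us) = \<theta>" "us @ q = q'" "count_list q' \<theta> = 1" "count_list q \<theta> = 1"
    for p us q q' :: "step list"
  proof (rule ccontr)
    assume "us \<noteq> []"
    hence "\<theta> \<in> set us" using that(1) last_in_set[of us] by simp
    hence "count_list us \<theta> \<noteq> 0" by (simp add: count_list_0_iff)
    moreover have "count_list us \<theta> + count_list q \<theta> = 1" using that by (metis count_list_append)
    ultimately show False using that(4) by simp
  qed
  from assms(1) consider us where "v = v' @ us" "us @ u = u'" | us where "v @ us = v'" "u = us @ u'"
    by (metis append_eq_append_conv2)
  moreover have c: "count_list u \<theta> = 1" "count_list u' \<theta> = 1" "last v = \<theta>" "last v' = \<theta>"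
    using assms(2-5) by (simp_all add: theta_walks_def B_walks_def)
  ultimately show ?thesis
  proof cases
    case 1
    have "last (v' @ us) = \<theta>" using 1(1) c(3) by metis
    hence "us = []" using 1(2) c(2,1) by (rule *)
    thus ?thesis using 1 by simp
  next
    case 2
    have "last (v @ us) = \<theta>" using 2(1) c(4) by metis
    hence "us = []" using 2(2)[symmetric] c(1,2) by (rule *)
    thus ?thesis using 2 by simp
  qed
qed

lemma sum_theta_walks:
  fixes f :: "step list \<Rightarrow> real"
  shows "(\<Sum>w | w \<in> theta_walks R \<theta> \<and> length w = m. f w) =
    (\<Sum>w | w \<in> A_walks R \<theta> \<and> length w = m. f w) +
    (\<Sum>k\<le>m. \<Sum>v | v \<in> theta_walks R \<theta> \<and> length v = k.
       \<Sum>u | u \<in> B_walks R \<theta> \<and> length u = m - k. f (v @ u))"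
proof -
  define T where "T = theta_walks R \<theta>"
  define A where "A = A_walks R \<theta>"
  define B where "B = B_walks R \<theta>"
  define S where "S = (SIGMA k:{..m}. {v \<in> T. length v = k} \<times> {u \<in> B. length u = m - k})"
  have bij: "bij_betw (\<lambda>(k, v, u). v @ u) S ({w \<in> T. length w = m} - {w \<in> A. length w = m})"
  proof (rule bij_betw_imageI)
    show "inj_on (\<lambda>(k, v, u). v @ u) S"
    proof (rule inj_onI)
      fix p q
      assume pq: "p \<in> S" "q \<in> S" "(case p of (k, v, u) \<Rightarrow> v @ u) = (case q of (k, v, u) \<Rightarrow> v @ u)"
      obtain k v u k' v' u' where [simp]: "p = (k, v, u)" "q = (k', v', u')" by (metis prod_cases3)
      have "v = v' \<and> u = u'"
        using pq by (intro B_walk_suffix_unique[of v u v' u' R \<theta>]) (auto simp: S_def T_def B_def)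
      thus "p = q" using pq by (auto simp: S_def)
    qed
    have sub: "w \<in> (\<lambda>(k, v, u). v @ u) ` S" if w: "w \<in> T" "length w = m" "w \<notin> A" for w
    proof -
      obtain v u where "w = v @ u" "v \<in> T" "u \<in> B"
        using theta_walk_split[of w R \<theta>] w unfolding T_def A_def B_def by blast
      thus ?thesis using w(2) by (intro image_eqI[of _ _ "(length v, v, u)"]) (auto simp: S_def)
    qed
    have sup: "v @ u \<in> T \<and> v @ u \<notin> A" if "v \<in> T" "u \<in> B" for v u
      using that theta_walk_append_B_walk[of v R \<theta> u] by (auto simp: T_def A_def B_def)
    show "(\<lambda>(k, v, u). v @ u) ` S = {w \<in> T. length w = m} - {w \<in> A. length w = m}"
    proof
      show "(\<lambda>(k, v, u). v @ u) ` S \<subseteq> {w \<in> T. length w = m} - {w \<in> A. length w = m}"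
        using sup by (auto simp: S_def)
      show "{w \<in> T. length w = m} - {w \<in> A. length w = m} \<subseteq> (\<lambda>(k, v, u). v @ u) ` S"
        using sub by blast
    qed
  qed
  have "(\<Sum>w\<in>{w \<in> T. length w = m} - {w \<in> A. length w = m}. f w) = (\<Sum>(k, v, u)\<in>S. f (v @ u))"
    using sum.reindex_bij_betw[OF bij, of f] by (simp add: case_prod_unfold)
  also have "\<dots> = (\<Sum>k\<le>m. \<Sum>v\<in>{v \<in> T. length v = k}. \<Sum>u\<in>{u \<in> B. length u = m - k}. f (v @ u))"
    unfolding S_def by (subst sum.Sigma[symmetric]) (auto simp: sum.cartesian_product)
  finally have "(\<Sum>w\<in>{w \<in> T. length w = m} - {w \<in> A. length w = m}. f w) = \<dots>" .
  moreover have "(\<Sum>w\<in>{w \<in> T. length w = m}. f w) =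
      (\<Sum>w\<in>{w \<in> T. length w = m} - {w \<in> A. length w = m}. f w) + (\<Sum>w\<in>{w \<in> A. length w = m}. f w)"
    using A_walks_subset_theta_walks[of R \<theta>]
    by (intro sum.subset_diff) (auto simp: T_def A_def)
  ultimately show ?thesis by (simp add: T_def A_def B_def)
qed

text \<open>
  The renewal equation \<open>T = A + T B\<close> and its formal derivative. They are stated for any
  multiplicative weight \<open>f\<close> and any \<open>g\<close> that obeys the product rule over \<open>f\<close>, as \<open>g = x \<partial>f/\<partial>x\<close> does.
\<close>
lemma gfps_theta_walks_multiplicative:
  assumes "\<And>v u. f (v @ u) = f v * f u"
  shows "gfps (theta_walks R \<theta>) f =
    gfps (A_walks R \<theta>) f + gfps (theta_walks R \<theta>) f * gfps (B_walks R \<theta>) f"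
proof (rule fps_ext)
  fix m
  show "fps_nth (gfps (theta_walks R \<theta>) f) m = fps_nth (gfps (A_walks R \<theta>) f +
      gfps (theta_walks R \<theta>) f * gfps (B_walks R \<theta>) f) m"
    unfolding gfps_nth fps_add_nth fps_mult_nth
    by (subst sum_theta_walks) (simp only: assms sum_product atMost_atLeast0)
qed

lemma gfps_theta_walks_derivation:
  assumes f: "\<And>v u. f (v @ u) = f v * f u" and g: "\<And>v u. g (v @ u) = g v * f u + f v * g u"
  shows "gfps (theta_walks R \<theta>) g = gfps (A_walks R \<theta>) g
    + gfps (theta_walks R \<theta>) g * gfps (B_walks R \<theta>) f
    + gfps (theta_walks R \<theta>) f * gfps (B_walks R \<theta>) g"
proof (rule fps_ext)
  fix m
  show "fps_nth (gfps (theta_walks R \<theta>) g) m = fps_nth (gfps (A_walks R \<theta>) g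
      + gfps (theta_walks R \<theta>) g * gfps (B_walks R \<theta>) f
      + gfps (theta_walks R \<theta>) f * gfps (B_walks R \<theta>) g) m"
    unfolding gfps_nth fps_add_nth fps_mult_nth
    by (subst sum_theta_walks) (simp only: g sum_product atMost_atLeast0 sum.distrib add.assoc)
qed

text \<open>
  Cutting an avoiding walk after \<open>n\<close> steps is injective and leaves two avoiding walks; the rule
  between the two parts is forgotten.
\<close>
lemma gfps_avoiding_walks_submultiplicative:
  fixes R :: rule and \<theta> :: step
  assumes "x > 0" "y > 0"
  defines "c \<equiv> \<lambda>m. fps_nth (gfps (avoiding_walks R \<theta>) (weight x y)) m"
  shows "c (n + m) \<le> c n * c m"
proof -
  let ?V = "\<lambda>m. {w \<in> avoiding_walks R \<theta>. length w = m}"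
  let ?h = "\<lambda>w. (take n w, drop n w)"
  have inj: "inj_on ?h (?V (n + m))" by (rule inj_onI) (metis append_take_drop_id fst_conv snd_conv)
  have "c (n + m) = (\<Sum>w\<in>?V (n + m). weight x y w)" by (simp add: c_def)
  also have "\<dots> = (\<Sum>w\<in>?V (n + m). case ?h w of (v, u) \<Rightarrow> weight x y v * weight x y u)"
    using weight_append[OF assms(1,2)] by (intro sum.cong) (simp_all flip: weight_append[OF assms(1,2)])
  also have "\<dots> = (\<Sum>(v, u)\<in>?h ` ?V (n + m). weight x y v * weight x y u)"
    by (subst sum.reindex[OF inj]) simp
  also have "\<dots> \<le> (\<Sum>(v, u)\<in>?V n \<times> ?V m. weight x y v * weight x y u)"
  proof (rule sum_mono2)
    show "?h ` ?V (n + m) \<subseteq> ?V n \<times> ?V m"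
    proof clarsimp
      fix w assume w: "w \<in> avoiding_walks R \<theta>" "length w = n + m"
      have "successively R (take n w @ drop n w)" using w by (simp add: avoiding_walks_def)
      thus "take n w \<in> avoiding_walks R \<theta> \<and> drop n w \<in> avoiding_walks R \<theta>"
        using w set_take_subset[of n w] set_drop_subset[of n w]
        unfolding successively_append_iff by (auto simp: avoiding_walks_def)
    qed
  qed (use assms in \<open>auto intro!: mult_nonneg_nonneg\<close>)
  also have "\<dots> = c n * c m" by (simp add: c_def sum_product sum.cartesian_product)
  finally show ?thesis .
qed

lemma fps_conv_radius_A_walks:
  assumes "x > 0" "y > 0"
  shows "fps_conv_radius (gfps (avoiding_walks R \<theta>) (weight x y)) \<le> fps_conv_radius (gfps (A_walks R \<theta>) (weight x y))"
proof -
  let ?V = "gfps (avoiding_walks R \<theta>) (weight x y)" and ?A = "gfps (A_walks R \<theta>) (weight x y)"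
  let ?F = "fps_const (weight x y [\<theta>]) * ?V * fps_X"
  have "fps_conv_radius ?V \<le> fps_conv_radius ?F"
    using fps_conv_radius_mult[of "fps_const (weight x y [\<theta>]) * ?V" fps_X]
      fps_conv_radius_mult[of "fps_const (weight x y [\<theta>])" ?V] by simp
  also have "fps_conv_radius ?F \<le> fps_conv_radius ?A"
  proof (rule fps_conv_radius_mono)
    fix n
    show "\<bar>fps_nth ?A n\<bar> \<le> \<bar>fps_nth ?F n\<bar>"
    proof (cases n)
      case 0
      have "{w. w \<in> A_walks R \<theta> \<and> length w = n} = {}" using 0 by (auto simp: A_walks_def walk_def)
      thus ?thesis by (simp only: gfps_nth) simp
    next
      case (Suc m)
      have "fps_nth ?A n \<le> (\<Sum>w\<in>(\<lambda>v. v @ [\<theta>]) ` {v \<in> avoiding_walks R \<theta>. length v = m}. weight x y w)"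
        unfolding gfps_nth
      proof (rule sum_mono2)
        show "{w. w \<in> A_walks R \<theta> \<and> length w = n} \<subseteq> (\<lambda>v. v @ [\<theta>]) ` {v \<in> avoiding_walks R \<theta>. length v = m}"
        proof clarify
          fix w assume w: "w \<in> A_walks R \<theta>" "n = length w"
          hence eq: "w = butlast w @ [\<theta>]" by (auto simp: A_walks_def walk_def)
          have "count_list (butlast w @ [\<theta>]) \<theta> = 1" "successively R (butlast w @ [\<theta>])"
            using w eq by (auto simp: A_walks_def walk_def)
          hence "butlast w \<in> avoiding_walks R \<theta>"
            by (auto simp: avoiding_walks_def successively_append_iff count_list_0_iff)
          thus "w \<in> (\<lambda>v. v @ [\<theta>]) ` {v \<in> avoiding_walks R \<theta>. length v = m}"
            using eq w Suc by (intro image_eqI[of _ _ "butlast w"]) auto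
        qed
      qed (use assms in auto)
      also have "\<dots> = fps_nth ?F n"
        using Suc by (subst sum.reindex) (auto simp: weight_append assms sum_distrib_left mult.commute inj_on_def)
      finally show ?thesis using sum_nonneg[of "{w. w \<in> A_walks R \<theta> \<and> length w = n}" "weight x y"] assms by simp
    qed
  qed
  finally show ?thesis .
qed

lemma fps_conv_radius_gfps_antimono:
  assumes "x > 0" "y > 0" "C \<subseteq> D"
  shows "fps_conv_radius (gfps D (weight x y)) \<le> fps_conv_radius (gfps C (weight x y))"
proof (rule fps_conv_radius_mono)
  fix n
  have "0 \<le> fps_nth (gfps C (weight x y)) n" using assms by (auto intro: sum_nonneg)
  moreover have "fps_nth (gfps C (weight x y)) n \<le> fps_nth (gfps D (weight x y)) n"
    using assms unfolding gfps_nth by (intro sum_mono2) auto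
  ultimately show "\<bar>fps_nth (gfps C (weight x y)) n\<bar> \<le> \<bar>fps_nth (gfps D (weight x y)) n\<bar>" by simp
qed

lemma abs_gfps_end_x_le:
  assumes "x > 0" "y > 0"
  shows "\<bar>fps_nth (gfps C (\<lambda>w. real_of_int (end_x w) * weight x y w)) m\<bar>
    \<le> real m * fps_nth (gfps C (weight x y)) m"
proof -
  have "\<bar>\<Sum>w | w \<in> C \<and> length w = m. real_of_int (end_x w) * weight x y w\<bar>
      \<le> (\<Sum>w | w \<in> C \<and> length w = m. real m * weight x y w)"
  proof (rule order_trans[OF sum_abs sum_mono])
    fix w assume "w \<in> {w. w \<in> C \<and> length w = m}"
    hence "\<bar>end_x w\<bar> \<le> int m" using abs_end_x_le[of w] by simp
    hence "\<bar>real_of_int (end_x w)\<bar> \<le> real m" by linarith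
    thus "\<bar>real_of_int (end_x w) * weight x y w\<bar> \<le> real m * weight x y w"
      using assms by (simp add: abs_mult mult_right_mono)
  qed
  thus ?thesis by (simp add: sum_distrib_left)
qed

lemma fps_conv_radius_gfps_end_x:
  assumes "x > 0" "y > 0"
  shows "fps_conv_radius (gfps C (weight x y))
    \<le> fps_conv_radius (gfps C (\<lambda>w. real_of_int (end_x w) * weight x y w))"
proof -
  let ?F = "gfps C (weight x y)"
  have "fps_conv_radius ?F \<le> fps_conv_radius (fps_X * fps_deriv ?F)"
    using fps_conv_radius_mult[of fps_X "fps_deriv ?F"] fps_conv_radius_deriv[of ?F] by simp
  also have "\<dots> \<le> fps_conv_radius (gfps C (\<lambda>w. real_of_int (end_x w) * weight x y w))"
  proof (rule fps_conv_radius_mono)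
    fix m
    have "0 \<le> fps_nth ?F m" using assms by (auto intro: sum_nonneg)
    moreover have "fps_nth (fps_X * fps_deriv ?F) m = real m * fps_nth ?F m"
      by (cases m) auto
    ultimately show "\<bar>fps_nth (gfps C (\<lambda>w. real_of_int (end_x w) * weight x y w)) m\<bar>
        \<le> \<bar>fps_nth (fps_X * fps_deriv ?F) m\<bar>" using abs_gfps_end_x_le[OF assms, of C m] by simp
  qed
  finally show ?thesis .
qed

text \<open>
  A walk that can follow \<open>\<theta>\<close> and ends with \<open>\<theta>\<close> is a concatenation of walks counted by \<open>B\<close>.
\<close>
lemma unit_powers_of_return_walks:
  fixes z :: complex
  assumes B: "\<And>u. u \<in> B_walks R \<theta> \<Longrightarrow> z ^ length u = 1"
  shows "w \<in> theta_walks R \<theta> \<Longrightarrow> R \<theta> (hd w) \<Longrightarrow> z ^ length w = 1"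
proof (induction "length w" arbitrary: w rule: less_induct)
  case less
  show ?case
  proof (cases "w \<in> A_walks R \<theta>")
    case True
    thus ?thesis using less.prems by (intro B) (auto simp: A_walks_def B_walks_def)
  next
    case False
    then obtain v u where w: "w = v @ u" "v \<in> theta_walks R \<theta>" "u \<in> B_walks R \<theta>"
      using theta_walk_split less.prems by blast
    have "u \<noteq> []" "v \<noteq> []" using w by (auto simp: B_walks_def theta_walks_def walk_def)
    hence "z ^ length v = 1" using less w by (intro less.hyps) auto
    thus ?thesis using B[OF w(3)] w(1) by (simp add: power_add)
  qed
qed

lemma aperiodic_B_walk_lengths:
  fixes z :: complex
  assumes "aperiodic R" and B: "\<And>u. u \<in> B_walks R \<theta> \<Longrightarrow> z ^ length u = 1"
  shows "z = 1"
proof -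
  obtain k where k: "k \<ge> 1"
    "\<exists>w. length w = k \<and> successively R (\<theta> # w) \<and> last (\<theta> # w) = \<theta>"
    "\<exists>w. length w = Suc k \<and> successively R (\<theta> # w) \<and> last (\<theta> # w) = \<theta>"
    by (rule aperiodic_imp_walks_of_consecutive_lengths[OF assms(1)]) blast
  have *: "z ^ length w = 1" if "successively R (\<theta> # w)" "last (\<theta> # w) = \<theta>" "w \<noteq> []" for w
  proof (rule unit_powers_of_return_walks[of R \<theta> z, OF B])
    show "w \<in> theta_walks R \<theta>" using that by (cases w) (simp_all add: theta_walks_def walk_def)
    show "R \<theta> (hd w)" using that by (cases w) simp_all
  qed
  have "z ^ k = 1"
  proof -
    obtain w where "length w = k" "successively R (\<theta> # w)" "last (\<theta> # w) = \<theta>" using k(2) by blast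
    thus ?thesis using *[of w] k(1) by fastforce
  qed
  moreover have "z ^ Suc k = 1"
  proof -
    obtain w where "length w = Suc k" "successively R (\<theta> # w)" "last (\<theta> # w) = \<theta>" using k(3) by blast
    thus ?thesis using *[of w] by fastforce
  qed
  ultimately show ?thesis by simp
qed

text \<open>
  Take any connection and discard what precedes its last visit (or, below, what follows its first
  visit) to \<open>\<theta>\<close>. The part found can be glued to an avoiding walk.
\<close>
lemma connect_from_theta:
  assumes "aperiodic R" "j \<noteq> \<theta>"
  shows "\<exists>p. successively R (\<theta> # p @ [j]) \<and> \<theta> \<notin> set p"
proof -
  obtain w where w: "successively R (\<theta> # w)" "last (\<theta> # w) = j"
    using aperiodic_imp_walks_of_consecutive_lengths[OF assms(1)] by metis
  obtain ys zs where ys: "\<theta> # w = ys @ \<theta> # zs" "\<theta> \<notin> set zs"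
    using split_list_last[of \<theta> "\<theta> # w"] by auto
  have "successively R (\<theta> # zs)" using w(1) unfolding ys(1) by (simp add: successively_append_iff)
  moreover have "last (\<theta> # zs) = j" using w(2) unfolding ys(1) by simp
  ultimately show ?thesis using assms(2) ys(2)
    by (cases zs rule: rev_cases) auto
qed

lemma connect_to_theta:
  assumes "aperiodic R" "j \<noteq> \<theta>"
  shows "\<exists>s. successively R (j # s @ [\<theta>]) \<and> \<theta> \<notin> set s"
proof -
  obtain w where w: "successively R (j # w)" "last (j # w) = \<theta>"
    using aperiodic_imp_walks_of_consecutive_lengths[OF assms(1)] by metis
  hence "\<theta> \<in> set w" using assms(2) last_in_set[of w] by (auto split: if_splits)
  then obtain ys zs where ys: "w = ys @ \<theta> # zs" "\<theta> \<notin> set ys"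
    using split_list_first[of \<theta> w] by auto
  have "successively R ((j # ys @ [\<theta>]) @ zs)" using w(1) ys by simp
  hence "successively R (j # ys @ [\<theta>])" unfolding successively_append_iff by blast
  thus ?thesis using ys(2) by blast
qed

lemma B_walks_nonempty:
  assumes "aperiodic R"
  shows "B_walks R \<theta> \<noteq> {}"
proof -
  obtain k where k: "k \<ge> 1" "\<exists>w. length w = k \<and> successively R (\<theta> # w) \<and> last (\<theta> # w) = \<theta>"
    by (rule aperiodic_imp_walks_of_consecutive_lengths[OF assms(1)]) blast
  then obtain w where w: "w \<noteq> []" "successively R (\<theta> # w)" "last w = \<theta>"
    by (metis last_ConsR list.size(3) not_one_le_zero)
  hence "\<theta> \<in> set w" using last_in_set[of w] by simp
  then obtain ys zs where ys: "w = ys @ \<theta> # zs" "\<theta> \<notin> set ys"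
    using split_list_first[of \<theta> w] by auto
  have "successively R ((\<theta> # ys @ [\<theta>]) @ zs)" using w(2) ys by simp
  hence "successively R (\<theta> # ys @ [\<theta>])" unfolding successively_append_iff by blast
  hence "ys @ [\<theta>] \<in> B_walks R \<theta>" using ys(2)
    by (auto simp: B_walks_def walk_def successively_Cons count_list_0_iff)
  thus ?thesis by blast
qed

lemma embed_avoiding_walk:
  assumes p: "successively R (\<theta> # p @ [i])" "\<theta> \<notin> set p"
    and s: "successively R (j # s @ [\<theta>])" "\<theta> \<notin> set s"
    and v: "v \<in> avoiding_walks R \<theta>" "v \<noteq> []" "hd v = i" "last v = j"
  shows "p @ v @ s @ [\<theta>] \<in> B_walks R \<theta>"
proof -
  have "successively R ((\<theta> # p) @ [i])" "successively R ([j] @ (s @ [\<theta>]))" using p s by auto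
  hence "successively R (\<theta> # p)" "R (last (\<theta> # p)) i" "successively R (s @ [\<theta>])" "R j (hd (s @ [\<theta>]))"
    unfolding successively_append_iff by auto
  hence "successively R ((\<theta> # p) @ (v @ (s @ [\<theta>])))"
    using v by (subst successively_append_iff, subst successively_append_iff) (auto simp: avoiding_walks_def)
  thus ?thesis using p s v
    by (auto simp: B_walks_def walk_def successively_Cons avoiding_walks_def count_list_0_iff)
qed

section \<open>The radius of convergence exceeds the root of B = 1\<close>

text \<open>
  A single term below \<open>1\<close> suffices: shifting by \<open>m\<close> multiplies the partial sums by at most \<open>d m < 1\<close>.
\<close>
lemma submultiplicative_summable:
  fixes d :: "nat \<Rightarrow> real"
  assumes nonneg: "\<And>n. d n \<ge> 0" and submult: "\<And>n k. d (n + k) \<le> d n * d k" and less: "d m < 1"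
  shows "summable d"
proof (rule summableI_nonneg_bounded[OF nonneg])
  fix N
  have "sum d {..<N} \<le> sum d {..<m + N}" using nonneg by (intro sum_mono2) auto
  also have "\<dots> = sum d {..<m} + (\<Sum>n<N. d (m + n))" by (induction N) simp_all
  also have "(\<Sum>n<N. d (m + n)) \<le> d m * sum d {..<N}"
    unfolding sum_distrib_left by (intro sum_mono submult)
  finally have "(1 - d m) * sum d {..<N} \<le> sum d {..<m}" by (simp add: algebra_simps)
  thus "sum d {..<N} \<le> sum d {..<m} / (1 - d m)" using less by (simp add: field_simps)
qed

lemma gfps_nonneg: "x > 0 \<Longrightarrow> y > 0 \<Longrightarrow> gfps C (weight x y) $ n \<ge> 0"
  by (auto intro: sum_nonneg)

lemma gfps_pos:
  assumes "x > 0" "y > 0" "w \<in> C"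
  shows "gfps C (weight x y) $ length w > 0"
  unfolding gfps_nth using assms by (intro sum_pos2[of _ w]) auto

text \<open>
  The condition on the single term of index \<open>m\<close> is open in \<open>s\<close>, so it persists slightly beyond \<open>s\<close>
  and gives convergence there.
\<close>
lemma avoiding_conv_radius_gt:
  fixes x y s :: real
  assumes xy: "x > 0" "y > 0" and s: "s \<ge> 0"
    and less: "gfps (avoiding_walks R \<theta>) (weight x y) $ m * s ^ m < 1" and m: "m \<ge> 1"
  shows "ereal s < fps_conv_radius (gfps (avoiding_walks R \<theta>) (weight x y))"
proof -
  let ?V = "gfps (avoiding_walks R \<theta>) (weight x y)"
  have "isCont (\<lambda>s. ?V $ m * s ^ m) s" by (intro continuous_intros)
  hence "eventually (\<lambda>s. ?V $ m * s ^ m < 1) (at s)"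
    using less by (intro order_tendstoD(2)) (auto simp: isCont_def)
  then obtain d where d: "d > 0" "\<And>s'. s' \<noteq> s \<Longrightarrow> dist s' s < d \<Longrightarrow> ?V $ m * s' ^ m < 1"
    by (auto simp: eventually_at)
  define s' where "s' = s + d / 2"
  have s': "s' > s" "?V $ m * s' ^ m < 1" using d by (auto simp: s'_def dist_real_def)
  have "summable (\<lambda>n. ?V $ n * s' ^ n)"
  proof (rule submultiplicative_summable[where m = m])
    show "?V $ n * s' ^ n \<ge> 0" for n using gfps_nonneg[OF xy] s' s by (simp del: gfps_nth)
    show "?V $ (n + k) * s' ^ (n + k) \<le> ?V $ n * s' ^ n * (?V $ k * s' ^ k)" for n k
    proof -
      have "?V $ (n + k) * s' ^ (n + k) \<le> ?V $ n * ?V $ k * s' ^ (n + k)"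
        using gfps_avoiding_walks_submultiplicative[OF xy, of R \<theta> n k] s' s
        by (intro mult_right_mono) simp_all
      also have "\<dots> = ?V $ n * s' ^ n * (?V $ k * s' ^ k)" by (simp only: power_add ac_simps)
      finally show ?thesis .
    qed
  qed (use s' in simp)
  hence "ereal \<bar>s'\<bar> \<le> fps_conv_radius ?V"
    unfolding fps_conv_radius_def using conv_radius_geI[of "fps_nth ?V" s'] by simp
  thus ?thesis using s' s by (simp add: less_le_trans[of _ "ereal s'"])
qed

lemma embedded_avoiding_walks_weight_le:
  fixes x y :: real
  assumes xy: "x > 0" "y > 0"
    and p: "successively R (\<theta> # p @ [i])" "\<theta> \<notin> set p"
    and s: "successively R (j # s @ [\<theta>])" "\<theta> \<notin> set s" and m: "m \<ge> 1"
  shows "(\<Sum>v | v \<in> avoiding_walks R \<theta> \<and> length v = m \<and> hd v = i \<and> last v = j. weight x y v) *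
      weight x y (p @ s @ [\<theta>]) \<le> gfps (B_walks R \<theta>) (weight x y) $ (m + length (p @ s @ [\<theta>]))"
proof -
  let ?W = "{v. v \<in> avoiding_walks R \<theta> \<and> length v = m \<and> hd v = i \<and> last v = j}"
  let ?e = "\<lambda>v. p @ v @ s @ [\<theta>]"
  have inj: "inj_on ?e ?W" by (simp add: inj_on_def)
  have "(\<Sum>v\<in>?W. weight x y v) * weight x y (p @ s @ [\<theta>]) = (\<Sum>w\<in>?e ` ?W. weight x y w)"
    by (subst sum.reindex[OF inj]) (simp add: weight_append[OF xy] sum_distrib_left sum_distrib_right ac_simps)
  also have "\<dots> \<le> (\<Sum>w | w \<in> B_walks R \<theta> \<and> length w = m + length (p @ s @ [\<theta>]). weight x y w)"
  proof (rule sum_mono2)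
    have "?e v \<in> B_walks R \<theta>" if "v \<in> ?W" for v
      using that m by (intro embed_avoiding_walk[OF p s]) auto
    thus "?e ` ?W \<subseteq> {w. w \<in> B_walks R \<theta> \<and> length w = m + length (p @ s @ [\<theta>])}"
      by (auto simp: add.assoc)
  qed (use xy in auto)
  finally show ?thesis by simp
qed

text \<open>
  By irreducibility every avoiding walk extends, by a prefix and a suffix depending only on its end
  directions, to a walk counted by \<open>B\<close>. So the terms of the avoiding series are bounded by finitely
  many constant multiples of shifted terms of \<open>B\<close>.
\<close>
lemma avoiding_terms_tendsto_0:
  fixes x y \<tau> :: real
  assumes aper: "aperiodic R" and xy: "x > 0" "y > 0" and \<tau>: "\<tau> > 0"
    and lim: "(\<lambda>m. gfps (B_walks R \<theta>) (weight x y) $ m * \<tau> ^ m) \<longlonglongrightarrow> 0"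
  shows "(\<lambda>m. gfps (avoiding_walks R \<theta>) (weight x y) $ m * \<tau> ^ m) \<longlonglongrightarrow> 0"
proof -
  let ?V = "gfps (avoiding_walks R \<theta>) (weight x y)" and ?B = "gfps (B_walks R \<theta>) (weight x y)"
  define c where "c i j m = (\<Sum>v | v \<in> avoiding_walks R \<theta> \<and> length v = m \<and> hd v = i \<and> last v = j. weight x y v)"
    for i j m
  have c_nonneg: "c i j m \<ge> 0" for i j m unfolding c_def using xy by (auto intro: sum_nonneg)
  have c0: "(\<lambda>m. c i j m * \<tau> ^ m) \<longlonglongrightarrow> 0" for i j
  proof (cases "i = \<theta> \<or> j = \<theta>")
    case True
    have "c i j m = 0" if "m \<ge> 1" for m
    proof -
      have "{v. v \<in> avoiding_walks R \<theta> \<and> length v = m \<and> hd v = i \<and> last v = j} = {}"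
      proof (intro equals0I; elim CollectE conjE)
        fix v assume v: "v \<in> avoiding_walks R \<theta>" "length v = m" "hd v = i" "last v = j"
        hence "v \<noteq> []" using that by auto
        hence "i \<in> set v" "j \<in> set v" using v hd_in_set[of v] last_in_set[of v] by auto
        thus False using True v(1) by (auto simp: avoiding_walks_def)
      qed
      thus ?thesis unfolding c_def by (simp only: sum.empty)
    qed
    hence "eventually (\<lambda>m. c i j m * \<tau> ^ m = 0) sequentially"
      by (intro eventually_mono[OF eventually_ge_at_top[of 1]]) simp
    thus ?thesis by (rule tendsto_eventually)
  next
    case False
    obtain p where p: "successively R (\<theta> # p @ [i])" "\<theta> \<notin> set p"
      using connect_from_theta[OF aper] False by blast
    obtain s where s: "successively R (j # s @ [\<theta>])" "\<theta> \<notin> set s"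
      using connect_to_theta[OF aper] False by blast
    define l where "l = length (p @ s @ [\<theta>])"
    define K where "K = weight x y (p @ s @ [\<theta>]) * \<tau> ^ l"
    have K: "K > 0" using xy \<tau> by (simp add: K_def)
    have "(\<lambda>m. ?B $ (m + l) * \<tau> ^ (m + l)) \<longlonglongrightarrow> 0"
      using lim by (rule LIMSEQ_ignore_initial_segment)
    hence limK: "(\<lambda>m. ?B $ (m + l) * \<tau> ^ (m + l) / K) \<longlonglongrightarrow> 0" by (rule tendsto_divide_zero)
    have "c i j m * \<tau> ^ m \<le> ?B $ (m + l) * \<tau> ^ (m + l) / K" if "m \<ge> 1" for m
    proof -
      have "c i j m * weight x y (p @ s @ [\<theta>]) * \<tau> ^ (m + l) \<le> ?B $ (m + l) * \<tau> ^ (m + l)"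
        unfolding c_def l_def using embedded_avoiding_walks_weight_le[OF xy p s that] \<tau>
        by (intro mult_right_mono) simp_all
      hence "c i j m * \<tau> ^ m * K \<le> ?B $ (m + l) * \<tau> ^ (m + l)"
        by (simp only: K_def power_add ac_simps)
      thus ?thesis using K by (simp only: pos_le_divide_eq)
    qed
    hence upper: "eventually (\<lambda>m. c i j m * \<tau> ^ m \<le> ?B $ (m + l) * \<tau> ^ (m + l) / K) sequentially"
      by (intro eventually_mono[OF eventually_ge_at_top[of 1]])
    have lower: "eventually (\<lambda>m. 0 \<le> c i j m * \<tau> ^ m) sequentially" using c_nonneg \<tau> by simp
    show ?thesis by (rule tendsto_sandwich[OF lower upper tendsto_const limK])
  qed
  have "?V $ m * \<tau> ^ m = (\<Sum>(i, j)\<in>UNIV. c i j m * \<tau> ^ m)" for m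
  proof -
    have "?V $ m = (\<Sum>q\<in>UNIV. \<Sum>v\<in>{v \<in> {v. v \<in> avoiding_walks R \<theta> \<and> length v = m}. (hd v, last v) = q}. weight x y v)"
      unfolding gfps_nth by (rule sum.group[symmetric]) auto
    also have "\<dots> = (\<Sum>(i, j)\<in>UNIV. c i j m)"
      unfolding c_def by (intro sum.cong refl) (auto intro!: sum.cong)
    finally show ?thesis by (simp add: sum_distrib_right case_prod_unfold)
  qed
  moreover have "(\<lambda>m. \<Sum>(i, j)\<in>UNIV. c i j m * \<tau> ^ m) \<longlonglongrightarrow> (\<Sum>(i::step, j::step)\<in>UNIV. 0)"
    unfolding case_prod_unfold by (intro tendsto_sum c0)
  ultimately show ?thesis by simp
qed

text \<open>
  Let \<open>\<tau>\<close> be the radius of convergence of the avoiding series. If \<open>B\<close> reaches \<open>1\<close> before \<open>\<tau>\<close>, the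
  intermediate value theorem gives \<open>\<rho>\<close>. Otherwise \<open>\<tau>\<close> is finite, since \<open>B\<close> has a positive
  coefficient of positive index, and by continuity the partial sums of \<open>B\<close> at \<open>\<tau>\<close> are at most \<open>1\<close>.
  Then the terms of \<open>B\<close>, and with them the terms of the avoiding series, tend to zero at \<open>\<tau>\<close>. By
  submultiplicativity the avoiding series would converge beyond \<open>\<tau>\<close>, a contradiction.
\<close>
lemma B_series_eq_1_exists:
  fixes x y :: real
  assumes aper: "aperiodic R" and xy: "x > 0" "y > 0"
  obtains \<rho> where "\<rho> > 0" "ereal \<rho> < fps_conv_radius (gfps (avoiding_walks R \<theta>) (weight x y))"
    "eval_fps (gfps (B_walks R \<theta>) (weight x y)) \<rho> = 1"
proof -
  let ?V = "gfps (avoiding_walks R \<theta>) (weight x y)" and ?B = "gfps (B_walks R \<theta>) (weight x y)"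
  have radB: "fps_conv_radius ?V \<le> fps_conv_radius ?B"
    using fps_conv_radius_A_walks[OF xy, of R \<theta>]
      fps_conv_radius_gfps_antimono[OF xy B_walks_subset_A_walks[of R \<theta>]] by order
  obtain u where u: "u \<in> B_walks R \<theta>" using B_walks_nonempty[OF aper] by blast
  have u1: "length u \<ge> 1" using u by (cases u) (auto simp: B_walks_def walk_def)
  have b: "?B $ length u > 0" using gfps_pos[OF xy u] .
  have B0: "?B $ 0 = 0"
  proof -
    have "{w. w \<in> B_walks R \<theta> \<and> length w = 0} = {}" by (auto simp: B_walks_def walk_def)
    thus ?thesis by (simp only: gfps_nth sum.empty)
  qed
  have Vpos: "0 < fps_conv_radius ?V"
    using avoiding_conv_radius_gt[OF xy, of 0 R \<theta> 1] by (simp add: zero_ereal_def)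
  have "\<exists>t>0. ereal t < fps_conv_radius ?V \<and> eval_fps ?B t \<ge> 1"
  proof (rule ccontr)
    assume "\<not> ?thesis"
    hence less1: "eval_fps ?B t < 1" if "t > 0" "ereal t < fps_conv_radius ?V" for t
      using that by (auto simp: not_le)
    have partial: "(\<Sum>n\<le>N. ?B $ n * t ^ n) \<le> 1" if "t > 0" "ereal t < fps_conv_radius ?V" for t N
    proof -
      have "ereal (norm t) < fps_conv_radius ?B" using that radB by (simp add: less_le_trans)
      hence "(\<lambda>n. ?B $ n * t ^ n) sums eval_fps ?B t" by (rule sums_eval_fps)
      moreover have "?B $ n * t ^ n \<ge> 0" for n using gfps_nonneg[OF xy] that by (simp del: gfps_nth)
      ultimately have "(\<Sum>n\<le>N. ?B $ n * t ^ n) \<le> eval_fps ?B t"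
        by (metis (no_types, lifting) finite_atMost sum_le_suminf sums_iff)
      thus ?thesis using less1[OF that] by linarith
    qed
    have "fps_conv_radius ?V \<noteq> \<infinity>"
    proof
      assume inf: "fps_conv_radius ?V = \<infinity>"
      \<comment> \<open>chosen so that a single term of the series already exceeds \<open>1\<close>\<close>
      define t where "t = 1 + 1 / ?B $ length u"
      have t: "t > 1" using b by (simp add: t_def del: gfps_nth)
      have "1 < ?B $ length u * t" using b by (simp add: t_def distrib_left del: gfps_nth)
      also have "\<dots> \<le> ?B $ length u * t ^ length u"
        using b t u1 by (intro mult_left_mono self_le_power) auto
      also have "\<dots> \<le> (\<Sum>n\<le>length u. ?B $ n * t ^ n)"
        using gfps_nonneg[OF xy] t by (intro member_le_sum) (auto simp del: gfps_nth)
      also have "\<dots> \<le> 1" using t inf by (intro partial) auto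
      finally show False by simp
    qed
    then obtain \<tau> where \<tau>: "fps_conv_radius ?V = ereal \<tau>" using Vpos by (cases "fps_conv_radius ?V") auto
    have \<tau>0: "\<tau> > 0" using Vpos \<tau> by simp
    have "(\<Sum>n\<le>N. ?B $ n * \<tau> ^ n) \<le> 1" for N
    proof (rule tendsto_upperbound)
      have "isCont (\<lambda>t. \<Sum>n\<le>N. ?B $ n * t ^ n) \<tau>" by (intro continuous_intros)
      thus "((\<lambda>t. \<Sum>n\<le>N. ?B $ n * t ^ n) \<longlongrightarrow> (\<Sum>n\<le>N. ?B $ n * \<tau> ^ n)) (at_left \<tau>)"
        by (auto simp: isCont_def intro: tendsto_within_subset)
      show "eventually (\<lambda>t. (\<Sum>n\<le>N. ?B $ n * t ^ n) \<le> 1) (at_left \<tau>)"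
        using eventually_at_left_real[OF \<tau>0] by (rule eventually_mono) (intro partial; simp add: \<tau>)
    qed simp
    hence "summable (\<lambda>n. ?B $ n * \<tau> ^ n)"
      using gfps_nonneg[OF xy] \<tau>0
      by (intro bounded_imp_summable[where B = 1]) (simp_all del: gfps_nth)
    hence "(\<lambda>n. ?B $ n * \<tau> ^ n) \<longlonglongrightarrow> 0" by (rule summable_LIMSEQ_zero)
    hence "(\<lambda>m. ?V $ m * \<tau> ^ m) \<longlonglongrightarrow> 0" by (rule avoiding_terms_tendsto_0[OF aper xy \<tau>0])
    hence "eventually (\<lambda>m. ?V $ m * \<tau> ^ m < 1) sequentially" by (rule order_tendstoD) simp
    hence "eventually (\<lambda>m. ?V $ m * \<tau> ^ m < 1 \<and> m \<ge> 1) sequentially"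
      using eventually_ge_at_top[of 1] by (rule eventually_conj)
    then obtain m where "?V $ m * \<tau> ^ m < 1" "m \<ge> 1" by (auto simp: eventually_sequentially)
    hence "ereal \<tau> < fps_conv_radius ?V" using avoiding_conv_radius_gt[OF xy] \<tau>0 by simp
    thus False using \<tau> by simp
  qed
  then obtain t where t: "t > 0" "ereal t < fps_conv_radius ?V" "eval_fps ?B t \<ge> 1" by blast
  have "continuous_on {0..t} (eval_fps ?B)"
  proof (rule continuous_on_subset[OF continuous_on_eval_fps])
    show "{0..t} \<subseteq> eball 0 (fps_conv_radius ?B)"
    proof (rule subsetI)
      fix u assume "u \<in> {0..t}"
      hence "ereal (dist 0 u) \<le> ereal t" by (simp add: dist_real_def)
      hence "ereal (dist 0 u) < fps_conv_radius ?B" using t(2) radB by order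
      thus "u \<in> eball 0 (fps_conv_radius ?B)" by (simp only: in_eball_iff)
    qed
  qed
  then obtain \<rho> where \<rho>: "0 \<le> \<rho>" "\<rho> \<le> t" "eval_fps ?B \<rho> = 1"
    using IVT'[of "eval_fps ?B" 0 1 t] t B0 by (auto simp: eval_fps_at_0 simp del: gfps_nth)
  have "\<rho> \<noteq> 0" using \<rho>(3) B0 by (auto simp: eval_fps_at_0 simp del: gfps_nth)
  moreover have "ereal \<rho> < fps_conv_radius ?V" using \<rho>(2) t(2) by (simp add: le_less_trans[of _ "ereal t"])
  ultimately show ?thesis using that[of \<rho>] \<rho> by simp
qed

section \<open>Generating functions of walks as convergent power series\<close>

text \<open>
  All terms are nonnegative, so the unordered sum may be grouped by length.
\<close>
lemma gen_fun_eq_suminf: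
  assumes "t > 0" "x > 0" "y > 0" and summable: "summable (\<lambda>m. gfps C (weight x y) $ m * t ^ m)"
  shows "gen_fun C t x y = (\<Sum>m. gfps C (weight x y) $ m * t ^ m)"
proof -
  define f where "f w = t ^ length w * x powi end_x w * y powi end_y w" for w
  let ?S = "SIGMA m:UNIV. {w \<in> C. length w = m}"
  let ?g = "\<lambda>m. gfps C (weight x y) $ m * t ^ m"
  have f_nonneg: "f w \<ge> 0" for w using assms by (simp add: f_def)
  have bij: "bij_betw snd ?S C" by (rule bij_betwI[where g = "\<lambda>w. (length w, w)"]) auto
  have level: "((\<lambda>w. f (snd (m, w))) has_sum ?g m) {w \<in> C. length w = m}" for m
    by (rule has_sum_finiteI) (auto simp: f_def weight_def sum_distrib_left sum_distrib_right ac_simps intro!: sum.cong)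
  have g: "(?g has_sum (\<Sum>m. ?g m)) UNIV"
    using summable gfps_nonneg[OF assms(2,3)] assms(1)
    by (intro sums_nonneg_imp_has_sum summable_sums) (simp_all del: gfps_nth)
  have "((\<lambda>p. f (snd p)) has_sum (\<Sum>m. ?g m)) ?S"
  proof (rule has_sum_SigmaI[OF level g])
    show "(\<lambda>p. f (snd p)) summable_on ?S"
      by (rule summable_on_SigmaI[OF level has_sum_imp_summable[OF g]]) (rule f_nonneg)
  qed
  hence "(f has_sum (\<Sum>m. ?g m)) C" by (rule iffD1[OF has_sum_reindex_bij_betw[OF bij]])
  thus ?thesis unfolding gen_fun_def f_def by (rule infsumI)
qed

lemma gen_fun_eq_eval_fps:
  assumes "t > 0" "x > 0" "y > 0" "ereal t < fps_conv_radius (gfps C (weight x y))"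
  shows "gen_fun C t x y = eval_fps (gfps C (weight x y)) t"
  unfolding eval_fps_def using assms by (intro gen_fun_eq_suminf summable_fps) auto

text \<open>
  A walk of length \<open>m\<close> moves at most \<open>m\<close> in the first coordinate, so a change of \<open>x\<close> by a factor
  costs no more than the same factor in \<open>t\<close>. This makes convergence in \<open>t\<close> beyond a point uniform in \<open>x\<close>
  nearby.
\<close>
lemma weight_le_scaled:
  assumes x: "x > 0" "x' > 0" and y: "y > 0" and c: "x' \<le> c * x" "x \<le> c * x'" and len: "length w = m"
  shows "weight x' y w \<le> c ^ m * weight x y w"
proof -
  have c1: "c \<ge> 1"
  proof (rule ccontr)
    assume "\<not> c \<ge> 1"
    hence "c * x < x" "c * x' < x'" using x by simp_all
    thus False using c by linarith
  qed
  define q where "q = x' / x"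
  have q: "q > 0" "q \<le> c" "inverse q \<le> c" using x c by (auto simp: q_def field_simps)
  have "q powi end_x w \<le> c ^ m"
  proof (cases "end_x w \<ge> 0")
    case True
    hence "q powi end_x w = q ^ nat (end_x w)" by (simp add: power_int_def)
    also have "\<dots> \<le> c ^ nat (end_x w)" using q by (intro power_mono) auto
    also have "\<dots> \<le> c ^ m" using c1 abs_end_x_le[of w] len by (intro power_increasing) auto
    finally show ?thesis .
  next
    case False
    hence "q powi end_x w = inverse q ^ nat (- end_x w)" by (simp add: power_int_def)
    also have "\<dots> \<le> c ^ nat (- end_x w)" using q by (intro power_mono) auto
    also have "\<dots> \<le> c ^ m" using c1 abs_end_x_le[of w] len by (intro power_increasing) auto
    finally show ?thesis .
  qed
  moreover have "x' = q * x" using x by (simp add: q_def)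
  hence "weight x' y w = q powi end_x w * weight x y w" by (simp add: weight_def power_int_mult_distrib)
  moreover have "weight x y w \<ge> 0" using x y by simp
  ultimately show ?thesis by (simp add: mult_right_mono)
qed

text \<open>
  Term-by-term differentiation. With \<open>s\<close> between \<open>t\<close> and the radius of convergence, the
  differentiated terms are dominated by \<open>m s^m\<close> times the coefficient at \<open>x\<close>, uniformly for \<open>x'\<close> within a
  factor \<open>c = s/t\<close> of \<open>x\<close>.
\<close>
lemma gen_fun_has_derivative_x:
  fixes t x y :: real
  assumes t: "t > 0" and x: "x > 0" and y: "y > 0"
    and rad: "ereal t < fps_conv_radius (gfps C (weight x y))"
  shows "((\<lambda>x'. gen_fun C t x' y) has_field_derivative
      eval_fps (gfps C (\<lambda>w. real_of_int (end_x w) * weight x y w)) t / x) (at x)"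
proof -
  let ?G = "\<lambda>x'. gfps C (weight x' y)"
  let ?G' = "\<lambda>x'. gfps C (\<lambda>w. real_of_int (end_x w) * weight x' y w)"
  obtain s where s: "t < s" "ereal s < fps_conv_radius (?G x)" using ereal_dense2[OF rad] by auto
  define c where "c = s / t"
  have c: "c > 1" "c * t = s" using s t by (auto simp: c_def)
  define S where "S = {x / c<..<c * x}"
  have S: "x' > 0" "x' \<le> c * x" "x \<le> c * x'" if "x' \<in> S" for x'
  proof -
    show "x' > 0" using that x c by (auto simp: S_def intro: less_trans[of 0 "x / c"])
    show "x' \<le> c * x" "x \<le> c * x'" using that c by (auto simp: S_def field_simps)
  qed
  have xS: "x \<in> S" using c x by (auto simp: S_def field_simps)
  have G_le: "?G x' $ m * t ^ m \<le> ?G x $ m * s ^ m" if "x' \<in> S" for x' m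
  proof -
    have "?G x' $ m \<le> c ^ m * ?G x $ m" unfolding gfps_nth sum_distrib_left
      using S[OF that] x y by (intro sum_mono weight_le_scaled) auto
    hence "?G x' $ m * t ^ m \<le> c ^ m * ?G x $ m * t ^ m" using t by (intro mult_right_mono) auto
    also have "\<dots> = ?G x $ m * s ^ m" by (simp only: c(2)[symmetric] power_mult_distrib ac_simps)
    finally show ?thesis .
  qed
  have summable_s: "summable (\<lambda>m. ?G x $ m * s ^ m)"
    using s t by (intro summable_fps) auto
  have summable: "summable (\<lambda>m. ?G x' $ m * t ^ m)" if "x' \<in> S" for x'
    using G_le[OF that] gfps_nonneg[OF S(1)[OF that] y] t
    by (intro summable_comparison_test'[OF summable_s]) (simp del: gfps_nth)
  define h where "h m x' = ?G x' $ m * t ^ m" for m x'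
  define h' where "h' m x' = ?G' x' $ m / x' * t ^ m" for m x'
  have deriv: "(h m has_field_derivative h' m x') (at x' within S)" if "x' \<in> S" for m x'
  proof -
    have "((\<lambda>x'. weight x' y w) has_field_derivative real_of_int (end_x w) * weight x' y w / x') (at x' within S)" for w
      unfolding weight_def using S(1)[OF that]
      by (auto intro!: derivative_eq_intros simp: power_int_diff)
    hence "(h m has_field_derivative (\<Sum>w | w \<in> C \<and> length w = m. real_of_int (end_x w) * weight x' y w / x') * t ^ m) (at x' within S)"
      unfolding h_def gfps_nth by (intro DERIV_sum DERIV_cmult_right)
    thus ?thesis by (simp add: h'_def sum_divide_distrib)
  qed
  have rad': "fps_conv_radius (?G x) \<le> fps_conv_radius (fps_X * fps_deriv (?G x))"
    using fps_conv_radius_mult[of fps_X "fps_deriv (?G x)"] fps_conv_radius_deriv[of "?G x"] by simp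
  have "summable (\<lambda>m. (fps_X * fps_deriv (?G x)) $ m * s ^ m)"
    using s t rad' by (intro summable_fps) (auto intro: less_le_trans)
  moreover have "(fps_X * fps_deriv (?G x)) $ m = real m * ?G x $ m" for m by (cases m) auto
  ultimately have "summable (\<lambda>m. real m * ?G x $ m * s ^ m)" by (simp only:)
  hence M: "summable (\<lambda>m. c / x * (real m * ?G x $ m * s ^ m))" by (rule summable_mult)
  have bound: "norm (h' m x') \<le> c / x * (real m * ?G x $ m * s ^ m)" if "x' \<in> S" for m x'
  proof -
    have "norm (h' m x') = \<bar>?G' x' $ m\<bar> * t ^ m * (1 / x')"
      using t S(1)[OF that] by (simp add: h'_def abs_mult del: gfps_nth)
    also have "\<dots> \<le> (real m * ?G x' $ m) * t ^ m * (1 / x')"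
      using abs_gfps_end_x_le[OF S(1)[OF that] y, of C m] t S(1)[OF that]
      by (intro mult_right_mono) (auto simp del: gfps_nth)
    also have "\<dots> \<le> (real m * ?G x' $ m) * t ^ m * (c / x)"
      using S[OF that] x t gfps_nonneg[OF S(1)[OF that] y]
      by (intro mult_left_mono) (auto simp: field_simps simp del: gfps_nth)
    also have "\<dots> = (real m * (?G x' $ m * t ^ m)) * (c / x)" by (simp only: ac_simps)
    also have "\<dots> \<le> (real m * (?G x $ m * s ^ m)) * (c / x)"
      using G_le[OF that] c x by (intro mult_right_mono mult_left_mono) auto
    finally show ?thesis by (simp only: ac_simps)
  qed
  have "uniformly_convergent_on S (\<lambda>n x'. \<Sum>m<n. h' m x')"
    using Weierstrass_m_test[of S h', OF bound M] by (auto simp: uniformly_convergent_on_def)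
  moreover have "summable (\<lambda>m. h m x)" using summable[OF xS] by (simp add: h_def)
  ultimately have D: "((\<lambda>x'. \<Sum>m. h m x') has_field_derivative (\<Sum>m. h' m x)) (at x)"
    using xS deriv by (intro has_field_derivative_series'(2)[of S h h' x x]) (auto simp: S_def)
  have "(\<Sum>m. h' m x) = eval_fps (?G' x) t / x"
  proof -
    have "ereal (norm t) < fps_conv_radius (?G' x)"
      using rad fps_conv_radius_gfps_end_x[OF x y, of C] t by simp
    hence "(\<lambda>m. ?G' x $ m * t ^ m) sums eval_fps (?G' x) t" by (rule sums_eval_fps)
    hence "(\<lambda>m. ?G' x $ m * t ^ m / x) sums (eval_fps (?G' x) t / x)" by (rule sums_divide)
    thus ?thesis by (simp add: h'_def sums_iff mult.commute del: gfps_nth)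
  qed
  with D have D': "((\<lambda>x'. \<Sum>m. h m x') has_field_derivative eval_fps (?G' x) t / x) (at x)" by simp
  show ?thesis
  proof (rule has_field_derivative_transform_within_open[OF D'])
    show "open S" "x \<in> S" using xS by (auto simp: S_def)
    show "(\<Sum>m. h m x') = gen_fun C t x' y" if "x' \<in> S" for x'
      unfolding h_def by (rule gen_fun_eq_suminf[symmetric]) (use t y S[OF that] summable[OF that] in auto)
  qed
qed

lemma partial_derivs_gen_fun:
  fixes t x y :: real
  assumes t: "t > 0" and x: "x > 0" and y: "y > 0"
    and rad: "ereal t < fps_conv_radius (gfps C (weight x y))"
  defines "G' \<equiv> gfps C (\<lambda>w. real_of_int (end_x w) * weight x y w)"
  shows "partial_deriv 1 0 0 (gen_fun C) t x y = eval_fps (fps_deriv (gfps C (weight x y))) t"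
    and "partial_deriv 0 1 0 (gen_fun C) t x y = eval_fps G' t / x"
    and "partial_deriv 1 1 0 (gen_fun C) t x y = eval_fps (fps_deriv G') t / x"
proof -
  let ?G = "gfps C (weight x y)"
  obtain s where s: "t < s" "ereal s < fps_conv_radius ?G" using ereal_dense2[OF rad] by auto
  have near: "ereal t' < fps_conv_radius ?G" if "t' \<in> {0<..<s}" for t'
    using that s(2) by (auto intro: less_trans[of _ "ereal s"])
  have tS: "t \<in> {0<..<s}" using t s by simp
  have "(eval_fps ?G has_field_derivative eval_fps (fps_deriv ?G) t) (at t)"
    using rad t by (intro has_field_derivative_eval_fps) auto
  hence "((\<lambda>t'. gen_fun C t' x y) has_field_derivative eval_fps (fps_deriv ?G) t) (at t)"
    by (rule has_field_derivative_transform_within_open[where S = "{0<..<s}"])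
       (use tS gen_fun_eq_eval_fps[OF _ x y near] in auto)
  thus "partial_deriv 1 0 0 (gen_fun C) t x y = eval_fps (fps_deriv ?G) t"
    by (simp add: partial_deriv_def DERIV_imp_deriv)
  have dx: "deriv (\<lambda>x'. gen_fun C t' x' y) x = eval_fps G' t' / x" if "t' \<in> {0<..<s}" for t'
    unfolding G'_def using that gen_fun_has_derivative_x[OF _ x y near[OF that]]
    by (intro DERIV_imp_deriv) auto
  show "partial_deriv 0 1 0 (gen_fun C) t x y = eval_fps G' t / x"
    using dx[OF tS] by (simp add: partial_deriv_def)
  have "ereal (norm t) < fps_conv_radius G'"
    unfolding G'_def using rad fps_conv_radius_gfps_end_x[OF x y, of C] t by simp
  hence "((\<lambda>t'. eval_fps G' t' / x) has_field_derivative eval_fps (fps_deriv G') t / x) (at t)"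
    by (intro DERIV_cdivide has_field_derivative_eval_fps)
  hence "((\<lambda>t'. deriv (\<lambda>x'. gen_fun C t' x' y) x) has_field_derivative eval_fps (fps_deriv G') t / x) (at t)"
    by (rule has_field_derivative_transform_within_open[where S = "{0<..<s}"]) (use tS dx in auto)
  thus "partial_deriv 1 1 0 (gen_fun C) t x y = eval_fps (fps_deriv G') t / x"
    by (simp add: partial_deriv_def DERIV_imp_deriv)
qed

lemma infsum_theta_count:
  fixes g :: "int \<Rightarrow> int \<Rightarrow> real"
  shows "(\<Sum>\<^sub>\<infinity>(a, b)\<in>UNIV. g a b * real (theta_count R \<theta> m a b)) =
    (\<Sum>w | w \<in> theta_walks R \<theta> \<and> length w = m. g (end_x w) (end_y w))"
proof -
  let ?W = "{w. w \<in> theta_walks R \<theta> \<and> length w = m}"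
  let ?e = "\<lambda>w. (end_x w, end_y w)"
  have count: "real (theta_count R \<theta> m a b) = real (card {w \<in> ?W. ?e w = (a, b)})" for a b
    unfolding theta_count_def theta_walks_def by (rule arg_cong[where f = "\<lambda>S. real (card S)"]) auto
  have "theta_count R \<theta> m a b = 0" if "(a, b) \<notin> ?e ` ?W" for a b
  proof -
    have "{w \<in> ?W. ?e w = (a, b)} = {}" using that by auto
    hence "real (theta_count R \<theta> m a b) = 0" unfolding count by (simp only: card.empty of_nat_0)
    thus ?thesis by simp
  qed
  hence "(\<Sum>\<^sub>\<infinity>(a, b)\<in>UNIV. g a b * real (theta_count R \<theta> m a b)) =
      (\<Sum>\<^sub>\<infinity>(a, b)\<in>?e ` ?W. g a b * real (theta_count R \<theta> m a b))"
    by (intro infsum_cong_neutral) auto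
  also have "\<dots> = (\<Sum>(a, b)\<in>?e ` ?W. g a b * real (theta_count R \<theta> m a b))" by simp
  also have "\<dots> = (\<Sum>p\<in>?e ` ?W. \<Sum>w\<in>{w \<in> ?W. ?e w = p}. g (end_x w) (end_y w))"
  proof (rule sum.cong[OF refl])
    fix p assume "p \<in> ?e ` ?W"
    obtain a b where p: "p = (a, b)" by (cases p)
    have "(\<Sum>w\<in>{w \<in> ?W. ?e w = (a, b)}. g (end_x w) (end_y w)) = (\<Sum>w\<in>{w \<in> ?W. ?e w = (a, b)}. g a b)"
      by (intro sum.cong) auto
    thus "(case p of (a, b) \<Rightarrow> g a b * real (theta_count R \<theta> m a b))
        = (\<Sum>w\<in>{w \<in> ?W. ?e w = p}. g (end_x w) (end_y w))"
      by (simp only: p prod.case count sum_constant mult.commute)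
  qed
  also have "\<dots> = (\<Sum>w\<in>?W. g (end_x w) (end_y w))" by (rule sum.image_gen[symmetric]) auto
  finally show ?thesis .
qed

lemma expected_x_eq:
  "expected_x R \<theta> m x y =
    gfps (theta_walks R \<theta>) (\<lambda>w. real_of_int (end_x w) * weight x y w) $ m /
    gfps (theta_walks R \<theta>) (weight x y) $ m"
proof -
  have "Theta R \<theta> m x y = gfps (theta_walks R \<theta>) (weight x y) $ m"
    using infsum_theta_count[of "\<lambda>a b. x powi a * y powi b" R \<theta> m]
    by (simp add: Theta_def weight_def ac_simps)
  moreover have "(\<Sum>\<^sub>\<infinity>(a, b)\<in>UNIV. of_int a * real (theta_count R \<theta> m a b) * x powi a * y powi b)
      = gfps (theta_walks R \<theta>) (\<lambda>w. real_of_int (end_x w) * weight x y w) $ m"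
    using infsum_theta_count[of "\<lambda>a b. of_int a * (x powi a * y powi b)" R \<theta> m]
    by (simp add: weight_def ac_simps)
  ultimately show ?thesis by (simp add: expected_x_def)
qed

text \<open>
  The function \<open>B\<close> is strictly increasing up to \<open>\<rho>\<close>, because some walk is counted by it.
\<close>
lemma rho_eqI:
  assumes aper: "aperiodic R" and xy: "x > 0" "y > 0" and \<rho>: "\<rho> > 0"
    and rad: "ereal \<rho> < fps_conv_radius (gfps (B_walks R \<theta>) (weight x y))"
    and one: "eval_fps (gfps (B_walks R \<theta>) (weight x y)) \<rho> = 1"
  shows "rho R \<theta> x y = \<rho>"
  unfolding rho_def
proof (rule Least_equality)
  let ?B = "gfps (B_walks R \<theta>) (weight x y)"
  show "\<rho> > 0 \<and> B_gf R \<theta> \<rho> x y = 1"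
    using \<rho> one gen_fun_eq_eval_fps[OF \<rho> xy rad] by (simp add: B_gf_def)
  fix t assume t: "t > 0 \<and> B_gf R \<theta> t x y = 1"
  show "\<rho> \<le> t"
  proof (rule ccontr)
    assume "\<not> \<rho> \<le> t"
    hence less: "t < \<rho>" by simp
    hence radt: "ereal t < fps_conv_radius ?B" using rad by (simp add: less_trans[of _ "ereal \<rho>"])
    have "eval_fps ?B t = 1"
      using t gen_fun_eq_eval_fps[OF _ xy radt] by (simp add: B_gf_def)
    hence "(\<lambda>n. ?B $ n * \<rho> ^ n - ?B $ n * t ^ n) sums (1 - 1)"
      using sums_eval_fps[of \<rho> ?B] sums_eval_fps[of t ?B] rad radt t \<rho> one
      by (intro sums_diff) (simp_all del: gfps_nth)
    hence sums0: "(\<lambda>n. ?B $ n * (\<rho> ^ n - t ^ n)) sums 0"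
      by (simp add: right_diff_distrib del: gfps_nth)
    obtain u where u: "u \<in> B_walks R \<theta>" using B_walks_nonempty[OF aper] by blast
    have "length u > 0" using u by (auto simp: B_walks_def walk_def)
    hence "t ^ length u < \<rho> ^ length u" using less t by (intro power_strict_mono) auto
    hence "0 < ?B $ length u * (\<rho> ^ length u - t ^ length u)"
      using gfps_pos[OF xy u] by (simp del: gfps_nth)
    moreover have "0 \<le> ?B $ n * (\<rho> ^ n - t ^ n)" for n
      using gfps_nonneg[OF xy] power_mono[of t \<rho> n] less t by (simp del: gfps_nth)
    ultimately have "0 < (\<Sum>n. ?B $ n * (\<rho> ^ n - t ^ n))"
      using sums0 by (intro suminf_pos2[of _ "length u"]) (auto simp: sums_iff simp del: gfps_nth)
    thus False using sums0 by (simp add: sums_iff del: gfps_nth)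
  qed
qed

lemma eval_fps_deriv_B_pos:
  assumes aper: "aperiodic R" and xy: "x > 0" "y > 0" and \<rho>: "\<rho> > 0"
    and rad: "ereal \<rho> < fps_conv_radius (gfps (B_walks R \<theta>) (weight x y))"
  shows "eval_fps (fps_deriv (gfps (B_walks R \<theta>) (weight x y))) \<rho> > 0"
proof -
  let ?B = "gfps (B_walks R \<theta>) (weight x y)"
  obtain u where u: "u \<in> B_walks R \<theta>" using B_walks_nonempty[OF aper] by blast
  have "u \<noteq> []" using u by (auto simp: B_walks_def walk_def)
  then obtain k where k: "length u = Suc k" by (cases u) auto
  have "ereal (norm \<rho>) < fps_conv_radius (fps_deriv ?B)"
    using rad fps_conv_radius_deriv[of ?B] \<rho> by simp
  hence "summable (\<lambda>n. fps_deriv ?B $ n * \<rho> ^ n)" by (rule summable_fps)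
  moreover have "0 < fps_deriv ?B $ k * \<rho> ^ k"
    using gfps_pos[OF xy u] \<rho> unfolding k by (simp del: gfps_nth)
  moreover have "0 \<le> fps_deriv ?B $ n * \<rho> ^ n" for n
    using gfps_nonneg[OF xy] \<rho> by (simp del: gfps_nth)
  ultimately show ?thesis unfolding eval_fps_def by (intro suminf_pos2[of _ k])
qed

lemma eval_fps_A_pos:
  assumes xy: "x > 0" "y > 0" and \<rho>: "\<rho> > 0"
    and rad: "ereal \<rho> < fps_conv_radius (gfps (A_walks R \<theta>) (weight x y))"
  shows "eval_fps (gfps (A_walks R \<theta>) (weight x y)) \<rho> > 0"
proof -
  let ?A = "gfps (A_walks R \<theta>) (weight x y)"
  have "[\<theta>] \<in> A_walks R \<theta>" by (simp add: A_walks_def walk_def)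
  hence "0 < ?A $ 1 * \<rho> ^ 1" using gfps_pos[OF xy, of "[\<theta>]"] \<rho> by (simp del: gfps_nth)
  moreover have "0 \<le> ?A $ n * \<rho> ^ n" for n using gfps_nonneg[OF xy] \<rho> by (simp del: gfps_nth)
  moreover have "summable (\<lambda>n. ?A $ n * \<rho> ^ n)" using rad \<rho> by (intro summable_fps) auto
  ultimately show ?thesis unfolding eval_fps_def by (intro suminf_pos2[of _ 1])
qed

section \<open>The expected endpoint\<close>

theorem lemma6:
  fixes R :: rule and \<theta> :: step and x y :: real
  assumes "aperiodic R" and "x > 0" and "y > 0"
  shows "(partial_deriv 0 1 0 (B_gf R \<theta>) (rho R \<theta> x y) x y \<noteq> 0 \<longrightarrow>
            (\<lambda>m. expected_x R \<theta> m x y) \<sim>[sequentially]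
              (\<lambda>m. x * delta_x R \<theta> x y * real m)) \<and>
         (partial_deriv 0 1 0 (B_gf R \<theta>) (rho R \<theta> x y) x y = 0 \<longrightarrow>
            (\<lambda>m. expected_x R \<theta> m x y) \<longlonglongrightarrow>
              x * (- (partial_deriv 1 1 0 (B_gf R \<theta>) (rho R \<theta> x y) x y /
                      partial_deriv 1 0 0 (B_gf R \<theta>) (rho R \<theta> x y) x y)
                   + partial_deriv 0 1 0 (A_gf R \<theta>) (rho R \<theta> x y) x y /
                     A_gf R \<theta> (rho R \<theta> x y) x y))"
proof -
  note xy = assms(2,3)
  define e where "e w = real_of_int (end_x w) * weight x y w" for w
  define A where "A = gfps (A_walks R \<theta>) (weight x y)"
  define A' where "A' = gfps (A_walks R \<theta>) e"
  define B where "B = gfps (B_walks R \<theta>) (weight x y)"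
  define B' where "B' = gfps (B_walks R \<theta>) e"
  define T where "T = gfps (theta_walks R \<theta>) (weight x y)"
  define D where "D = gfps (theta_walks R \<theta>) e"
  obtain \<rho> where \<rho>: "\<rho> > 0" "ereal \<rho> < fps_conv_radius (gfps (avoiding_walks R \<theta>) (weight x y))"
      "eval_fps B \<rho> = 1"
    using B_series_eq_1_exists[OF assms] unfolding B_def by blast
  have radA: "ereal \<rho> < fps_conv_radius A"
    using \<rho>(2) fps_conv_radius_A_walks[OF xy, of R \<theta>] unfolding A_def by order
  have radB: "ereal \<rho> < fps_conv_radius B"
    using radA fps_conv_radius_gfps_antimono[OF xy B_walks_subset_A_walks[of R \<theta>]]
    unfolding A_def B_def by order
  have radA': "ereal \<rho> < fps_conv_radius A'"
    using radA fps_conv_radius_gfps_end_x[OF xy, of "A_walks R \<theta>"]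
    unfolding A_def A'_def e_def by order
  have radB': "ereal \<rho> < fps_conv_radius B'"
    using radB fps_conv_radius_gfps_end_x[OF xy, of "B_walks R \<theta>"]
    unfolding B_def B'_def e_def by order
  have rho: "rho R \<theta> x y = \<rho>"
    using rho_eqI[OF assms \<rho>(1)] radB \<rho>(3) unfolding B_def by blast
  have Bt: "partial_deriv 1 0 0 (B_gf R \<theta>) \<rho> x y = eval_fps (fps_deriv B) \<rho>"
    and Bx: "partial_deriv 0 1 0 (B_gf R \<theta>) \<rho> x y = eval_fps B' \<rho> / x"
    and Btx: "partial_deriv 1 1 0 (B_gf R \<theta>) \<rho> x y = eval_fps (fps_deriv B') \<rho> / x"
    using partial_derivs_gen_fun[OF \<rho>(1) xy radB[unfolded B_def]]
    by (simp_all add: B_gf_def B_def B'_def e_def[abs_def])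
  have Ax: "partial_deriv 0 1 0 (A_gf R \<theta>) \<rho> x y = eval_fps A' \<rho> / x"
    and A\<rho>: "A_gf R \<theta> \<rho> x y = eval_fps A \<rho>"
    using partial_derivs_gen_fun(2)[OF \<rho>(1) xy radA[unfolded A_def]]
      gen_fun_eq_eval_fps[OF \<rho>(1) xy radA[unfolded A_def]]
    by (simp_all add: A_gf_def A_def A'_def e_def[abs_def])
  define \<mu> where "\<mu> = \<rho> * eval_fps (fps_deriv B) \<rho>"
  define \<phi> where "\<phi> = eval_fps A \<rho> * eval_fps B' \<rho> / \<mu>\<^sup>2"
  have B'pos: "eval_fps (fps_deriv B) \<rho> > 0"
    using eval_fps_deriv_B_pos[OF assms \<rho>(1) radB[unfolded B_def]] by (simp add: B_def)
  have \<mu>: "\<mu> > 0" using B'pos \<rho> by (simp add: \<mu>_def)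
  have Apos: "eval_fps A \<rho> > 0" using eval_fps_A_pos[OF xy \<rho>(1) radA[unfolded A_def]] by (simp add: A_def)
  have B_nonneg: "B $ k \<ge> 0" for k unfolding B_def by (rule gfps_nonneg[OF xy])
  have "z = 1" if "\<forall>k. B $ k \<noteq> 0 \<longrightarrow> z ^ k = 1" for z :: complex
  proof (rule aperiodic_B_walk_lengths[OF assms(1)])
    fix u assume "u \<in> B_walks R \<theta>"
    hence "B $ length u \<noteq> 0" using gfps_pos[OF xy] unfolding B_def by (metis less_irrefl)
    thus "z ^ length u = 1" using that by blast
  qed
  hence aper: "\<forall>z::complex. (\<forall>k. B $ k \<noteq> 0 \<longrightarrow> z ^ k = 1) \<longrightarrow> z = 1" by blast
  have e_append: "e (v @ w) = e v * weight x y w + weight x y v * e w" for v w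
    by (simp add: e_def weight_append[OF xy] algebra_simps)
  have T: "T = A + T * B"
    unfolding T_def A_def B_def by (rule gfps_theta_walks_multiplicative[OF weight_append[OF xy]])
  have D: "D = A' + D * B + T * B'"
    unfolding T_def A'_def B_def B'_def D_def
    by (rule gfps_theta_walks_derivation[OF weight_append[OF xy] e_append])
  note asymp = renewal_asymptotics[OF B_nonneg \<rho>(1) radA radA' radB radB' \<rho>(3) aper
      less_imp_neq[OF B'pos, symmetric] T D, folded \<mu>_def, folded \<phi>_def]
  have E: "expected_x R \<theta> m x y = (D $ m * \<rho> ^ m) / (T $ m * \<rho> ^ m)" for m
    using \<rho>(1) by (simp add: expected_x_eq D_def T_def e_def[abs_def] del: gfps_nth)
  have T_lim: "(\<lambda>m. T $ m * \<rho> ^ m) \<longlonglongrightarrow> eval_fps A \<rho> / \<mu>" by (rule asymp(1))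
  have T_ne: "eval_fps A \<rho> / \<mu> \<noteq> 0" using Apos \<mu> by simp
  show ?thesis unfolding rho delta_x_def Bt Bx Btx Ax A\<rho>
  proof (intro conjI impI)
    assume "eval_fps B' \<rho> / x \<noteq> 0"
    define \<delta> where "\<delta> = x * (eval_fps B' \<rho> / x / (\<rho> * eval_fps (fps_deriv B) \<rho>))"
    have \<delta>: "\<delta> = eval_fps B' \<rho> / \<mu>" using xy by (simp add: \<delta>_def \<mu>_def)
    have "\<delta> \<noteq> 0" using \<open>eval_fps B' \<rho> / x \<noteq> 0\<close> \<mu> by (simp add: \<delta>)
    obtain c where "(\<lambda>m. D $ m * \<rho> ^ m - real (Suc m) * \<phi>) \<longlonglongrightarrow> c" using asymp(2) by blast
    hence "(\<lambda>m. (D $ m * \<rho> ^ m - real (Suc m) * \<phi>) * inverse (real m)) \<longlonglongrightarrow> c * 0"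
      by (rule tendsto_mult[OF _ lim_inverse_n])
    hence "(\<lambda>m. (D $ m * \<rho> ^ m - real (Suc m) * \<phi>) * inverse (real m) + real (Suc m) / real m * \<phi>)
        \<longlonglongrightarrow> c * 0 + 1 * \<phi>"
      by (rule tendsto_add[OF _ tendsto_mult[OF LIMSEQ_Suc_n_over_n tendsto_const]])
    moreover have "(D $ m * \<rho> ^ m - real (Suc m) * \<phi>) * inverse (real m) + real (Suc m) / real m * \<phi>
        = D $ m * \<rho> ^ m / real m" for m
      by (simp add: divide_inverse algebra_simps)
    ultimately have "(\<lambda>m. D $ m * \<rho> ^ m / real m) \<longlonglongrightarrow> \<phi>"
      by simp
    hence "(\<lambda>m. D $ m * \<rho> ^ m / real m / (T $ m * \<rho> ^ m)) \<longlonglongrightarrow> \<phi> / (eval_fps A \<rho> / \<mu>)"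
      by (intro tendsto_divide T_lim T_ne)
    also have "\<phi> / (eval_fps A \<rho> / \<mu>) = \<delta>"
      using Apos \<mu> by (simp add: \<phi>_def \<delta> power2_eq_square field_simps)
    finally have "(\<lambda>m. D $ m * \<rho> ^ m / real m / (T $ m * \<rho> ^ m) / \<delta>) \<longlonglongrightarrow> \<delta> / \<delta>"
      using \<open>\<delta> \<noteq> 0\<close> by (intro tendsto_divide tendsto_const)
    moreover have "a / b / c / d = a / c / (d * b)" for a b c d :: real by (simp add: ac_simps)
    ultimately have "(\<lambda>m. expected_x R \<theta> m x y / (\<delta> * real m)) \<longlonglongrightarrow> 1"
      using \<open>\<delta> \<noteq> 0\<close> by (simp only: E divide_self not_False_eq_True)
    thus "(\<lambda>m. expected_x R \<theta> m x y) \<sim>[sequentially]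
        (\<lambda>m. x * (eval_fps B' \<rho> / x / (\<rho> * eval_fps (fps_deriv B) \<rho>)) * real m)"
      unfolding \<delta>_def by (rule asymp_equivI')
  next
    assume "eval_fps B' \<rho> / x = 0"
    hence "eval_fps B' \<rho> = 0" using xy by simp
    hence "(\<lambda>m. D $ m * \<rho> ^ m) \<longlonglongrightarrow>
        eval_fps A' \<rho> / \<mu> - eval_fps A \<rho> * (\<rho> * eval_fps (fps_deriv B') \<rho>) / \<mu>\<^sup>2"
      by (rule asymp(3))
    hence "(\<lambda>m. expected_x R \<theta> m x y) \<longlonglongrightarrow>
        (eval_fps A' \<rho> / \<mu> - eval_fps A \<rho> * (\<rho> * eval_fps (fps_deriv B') \<rho>) / \<mu>\<^sup>2) / (eval_fps A \<rho> / \<mu>)"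
      unfolding E by (intro tendsto_divide T_lim T_ne)
    also have "(eval_fps A' \<rho> / \<mu> - eval_fps A \<rho> * (\<rho> * eval_fps (fps_deriv B') \<rho>) / \<mu>\<^sup>2) / (eval_fps A \<rho> / \<mu>)
        = eval_fps A' \<rho> / eval_fps A \<rho> - \<rho> * eval_fps (fps_deriv B') \<rho> / \<mu>"
      using Apos \<mu> by (simp add: field_simps power2_eq_square)
    also have "\<dots> = x * (- (eval_fps (fps_deriv B') \<rho> / x / eval_fps (fps_deriv B) \<rho>)
        + eval_fps A' \<rho> / x / eval_fps A \<rho>)"
      using Apos B'pos \<rho>(1) xy by (simp add: \<mu>_def field_simps)
    finally show "(\<lambda>m. expected_x R \<theta> m x y) \<longlonglongrightarrow>
        x * (- (eval_fps (fps_deriv B') \<rho> / x / eval_fps (fps_deriv B) \<rho>)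
        + eval_fps A' \<rho> / x / eval_fps A \<rho>)" .
  qed
qed

end
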